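(* Let $\alpha=\{\alpha_n\}_{n=1}^\infty\subset(0,1)$ be a sequence of ratios, let $C\subset[0,1]$ be the associated generalized Cantor set, let $I=[0,1]\setminus C$, and for $n\ge 1$ let $l_n=2^{-(n-1)}(1-\alpha_1)\cdots(1-\alpha_{n-1})\alpha_n$ be the common length of the $2^{n-1}$ open intervals removed at the $n$-th step of the construction. Suppose that there exists $0<\delta<1$ such that $$\sum_{n=1}^{\infty} l_n^{1/4^{n/\delta}}<\infty .$$ Then the determinantal point processes $\mathbb{P}_{K_C}$ and $\mathbb{P}_{K_I}$ on $\mathbb{R}$, with correlation kernels $K_C(x,y)=\widehat{\chi_C}(x-y)$ and $K_I(x,y)=\widehat{\chi_I}(x-y)$ with respect to Lebesgue measure, are both number rigid.
   Context: Generalized Cantor sets. Given $\alpha=\{\alpha_n\}_{n\ge1}$ with $0<\alpha_n<1$, put $C_0=[0,1]$; for $n\ge1$, $C_n$ is obtained from $C_{n-1}$ (a disjoint union of $2^{n-1}$ closed intervals of equal length) by removing from each constituent interval $J$ the open interval with the same midpoint as $J$ and length $\alpha_n$ times the length of $J$. The generalized Cantor set is $C=\bigcap_{n\ge1}C_n$, and $I=[0,1]\setminus C$ is its complement in $[0,1]$. The open intervals removed at step $n$ are $2^{n-1}$ in number and all have length $l_n=2^{-(n-1)}(1-\alpha_1)\cdots(1-\alpha_{n-1})\alpha_n$ (with $l_1=\alpha_1$). Fourier transform: for $g\in L^1(\mathbb{R})$, $\widehat g(\xi)=\int_{\mathbb{R}}g(x)e^{-2\pi i x\xi}\,dx$;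 $\chi_M$ is the indicator function of $M$. Point processes. $\mathrm{Conf}(\mathbb{R})$ is the space of locally finite configurations $X=\sum_i\delta_{x_i}$ on $\mathbb{R}$ (i.e. $X(\Delta)<\infty$ for every compact $\Delta$), with the vague topology (the weakest topology making $X\mapsto\int f\,dX$ continuous for every compactly supported continuous $f$). A point process on $\mathbb{R}$ is a Borel probability measure on $\mathrm{Conf}(\mathbb{R})$. A configuration is simple if $X(\{x\})\le1$ for all $x$, and is then identified with the subset $\{x_i\}$; a point process is simple if almost every configuration is simple. A simple point process $\mathbb{P}$ on $\mathbb{R}$ is determinantal with correlation kernel $K:\mathbb{R}\times\mathbb{R}\to\mathbb{C}$ with respect to Lebesgue measure if for every $n\ge1$ and every bounded compactly supported measurable $\varphi:\mathbb{R}^n\to\mathbb{C}$, $$\mathbb{E}_{\mathbb{P}}\Big[\sum_{x_1,\dots,x_n\in X\text{ distinct}}\varphi(x_1,\dots,x_n)\Big]=\int_{\mathbb{R}^n}\varphi(x_1,\dots,x_n)\det[K(x_i,x_j)]_{1\le i,j\le n}\,dx_1\cdots dx_n .$$ It is denoted $\mathbb{P}_K$. For the kernels $K_C$, $K_I$ the integral operators on $L^2(\mathbb{R})$ are locally trace class, positive and contractive, so by the theorem of Macchi, Soshnikov and Shirai–Takahashi the processes $\mathbb{P}_{K_C}$ and $\mathbb{P}_{K_I}$ exist and are unique. Number rigidity. For a Borel set $S\subset\mathbb{R}$ let $\mathcal{F}_S$ be the $\sigma$-algebra on $\mathrm{Conf}(\mathbb{R})$ generated by the counting functions $\#_B:X\mapsto\#(B\cap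 X)$, $B\subset S$ Borel, and let $\mathcal{F}_S^{\mathbb{P}}$ be its completion with respect to $\mathbb{P}$. The point process $\mathbb{P}$ is number rigid if for every compact $B\subset\mathbb{R}$ the random variable $\#_B$ is $\mathcal{F}_{\mathbb{R}\setminus B}^{\mathbb{P}}$-measurable. *)

theory Defs
  imports "HOL-Probability.Probability" "Jordan_Normal_Form.Determinant"
begin

section \<open>Generalized Cantor sets\<close>

text \<open>Sequences start at index 1; the value \<open>\<alpha> 0\<close> is never used.
  A pair \<open>(a, b)\<close> stands for the constituent interval \<open>[a, b]\<close>, from which the middle open interval
  of length \<open>\<alpha> (n + 1) * (b - a)\<close> is removed in step \<open>n + 1\<close>;
  see \<open>cantor_stage_Suc\<close> and \<open>cantor_gap_length\<close> below.\<close>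

primrec cantor_intervals :: "(nat \<Rightarrow> real) \<Rightarrow> nat \<Rightarrow> (real \<times> real) set" where
  "cantor_intervals \<alpha> 0 = {(0, 1)}"
| "cantor_intervals \<alpha> (Suc n) = (\<Union>(a, b)\<in>cantor_intervals \<alpha> n.
     {(a, (a + b) / 2 - \<alpha> (Suc n) * (b - a) / 2), ((a + b) / 2 + \<alpha> (Suc n) * (b - a) / 2, b)})"

definition cantor_stage :: "(nat \<Rightarrow> real) \<Rightarrow> nat \<Rightarrow> real set" where
  "cantor_stage \<alpha> n = (\<Union>(a, b)\<in>cantor_intervals \<alpha> n. {a..b})"

definition cantor_set :: "(nat \<Rightarrow> real) \<Rightarrow> real set" where
  "cantor_set \<alpha> = (\<Inter>n\<in>{1..}. cantor_stage \<alpha> n)"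

definition cantor_complement :: "(nat \<Rightarrow> real) \<Rightarrow> real set" where
  "cantor_complement \<alpha> = {0..1} - cantor_set \<alpha>"

definition gap_length :: "(nat \<Rightarrow> real) \<Rightarrow> nat \<Rightarrow> real" where
  "gap_length \<alpha> n = (1 / 2) ^ (n - 1) * (\<Prod>k = 1..n - 1. 1 - \<alpha> k) * \<alpha> n"

lemma cantor_intervals_less:
  assumes "\<And>n. n \<ge> 1 \<Longrightarrow> 0 < \<alpha> n \<and> \<alpha> n < 1" and "(a, b) \<in> cantor_intervals \<alpha> n"
  shows "a < b"
  using assms(2)
proof (induction n arbitrary: a b)
  case (Suc n)
  then obtain c d where cd: "(c, d) \<in> cantor_intervals \<alpha> n"
    and ab: "(a, b) = (c, (c + d) / 2 - \<alpha> (Suc n) * (d - c) / 2) \<or>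
      (a, b) = ((c + d) / 2 + \<alpha> (Suc n) * (d - c) / 2, d)" by auto
  have "\<alpha> (Suc n) * (d - c) < 1 * (d - c)"
    using assms(1)[of "Suc n"] Suc.IH[OF cd] by (intro mult_strict_right_mono) auto
  with ab show ?case by (auto simp: field_simps)
qed auto

lemma cantor_intervals_disjoint:
  assumes "\<And>n. n \<ge> 1 \<Longrightarrow> 0 < \<alpha> n \<and> \<alpha> n < 1"
    and "(a, b) \<in> cantor_intervals \<alpha> n" "(c, d) \<in> cantor_intervals \<alpha> n" "(a, b) \<noteq> (c, d)"
  shows "b < c \<or> d < a"
  using assms(2-4)
proof (induction n arbitrary: a b c d)
  case (Suc n)
  define h where "h = (\<lambda>a b. \<alpha> (Suc n) * (b - a) / 2)"
  from Suc.prems obtain p q r s where pq: "(p, q) \<in> cantor_intervals \<alpha> n"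
    and rs: "(r, s) \<in> cantor_intervals \<alpha> n"
    and ab: "(a, b) = (p, (p + q) / 2 - h p q) \<or> (a, b) = ((p + q) / 2 + h p q, q)"
    and cd: "(c, d) = (r, (r + s) / 2 - h r s) \<or> (c, d) = ((r + s) / 2 + h r s, s)"
    unfolding h_def by auto
  have pos: "0 < h u v \<and> h u v < (v - u) / 2" if "(u, v) \<in> cantor_intervals \<alpha> n" for u v
  proof -
    have uv: "u < v" using assms(1) that by (rule cantor_intervals_less)
    have "\<alpha> (Suc n) * (v - u) < 1 * (v - u)"
      using assms(1)[of "Suc n"] uv by (intro mult_strict_right_mono) auto
    then show ?thesis using assms(1)[of "Suc n"] uv by (auto simp: h_def)
  qed
  show ?case
  proof (cases "(p, q) = (r, s)")
    case True
    then show ?thesis using ab cd Suc.prems(3) pos[OF pq] by auto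
  next
    case False
    then have "q < r \<or> s < p" using Suc.IH pq rs by blast
    then show ?thesis using ab cd pos[OF pq] pos[OF rs] by (auto simp: field_simps)
  qed
qed auto

lemma cantor_stage_Suc:
  assumes "\<And>n. n \<ge> 1 \<Longrightarrow> 0 < \<alpha> n \<and> \<alpha> n < 1"
  shows "cantor_stage \<alpha> (Suc n) = cantor_stage \<alpha> n -
    (\<Union>(a, b)\<in>cantor_intervals \<alpha> n.
      {(a + b) / 2 - \<alpha> (Suc n) * (b - a) / 2 <..< (a + b) / 2 + \<alpha> (Suc n) * (b - a) / 2})"
proof -
  define h where "h = (\<lambda>a b. \<alpha> (Suc n) * (b - a) / 2)"
  have pos: "0 < h u v \<and> h u v < (v - u) / 2" if "(u, v) \<in> cantor_intervals \<alpha> n" for u v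
  proof -
    have uv: "u < v" using assms that by (rule cantor_intervals_less)
    have "\<alpha> (Suc n) * (v - u) < 1 * (v - u)"
      using assms[of "Suc n"] uv by (intro mult_strict_right_mono) auto
    then show ?thesis using assms[of "Suc n"] uv by (auto simp: h_def)
  qed
  have split: "x \<in> {a..(a + b) / 2 - h a b} \<union> {(a + b) / 2 + h a b..b} \<longleftrightarrow>
      x \<in> {a..b} \<and> x \<notin> {(a + b) / 2 - h a b <..< (a + b) / 2 + h a b}"
    if "(a, b) \<in> cantor_intervals \<alpha> n" for a b x
    using pos[OF that] by (auto simp: field_simps)
  have uniq: "(a, b) = (c, d)"
    if "(a, b) \<in> cantor_intervals \<alpha> n" "(c, d) \<in> cantor_intervals \<alpha> n"
      "x \<in> {a..b}" "x \<in> {(c + d) / 2 - h c d <..< (c + d) / 2 + h c d}" for a b c d x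
  proof (rule ccontr)
    assume "(a, b) \<noteq> (c, d)"
    then have "b < c \<or> d < a" using cantor_intervals_disjoint[OF assms that(1,2)] by blast
    then show False using that(3,4) pos[OF that(2)] by (auto simp: field_simps)
  qed
  have stage: "x \<in> cantor_stage \<alpha> n \<longleftrightarrow> (\<exists>a b. (a, b) \<in> cantor_intervals \<alpha> n \<and> x \<in> {a..b})" for x
    by (force simp: cantor_stage_def)
  have stageS: "x \<in> cantor_stage \<alpha> (Suc n) \<longleftrightarrow> (\<exists>a b. (a, b) \<in> cantor_intervals \<alpha> n \<and>
      x \<in> {a..(a + b) / 2 - h a b} \<union> {(a + b) / 2 + h a b..b})" for x
    unfolding cantor_stage_def h_def by force
  have "x \<in> cantor_stage \<alpha> (Suc n) \<longleftrightarrow> x \<in> cantor_stage \<alpha> n \<and>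
      \<not> (\<exists>c d. (c, d) \<in> cantor_intervals \<alpha> n \<and>
        x \<in> {(c + d) / 2 - h c d <..< (c + d) / 2 + h c d})" for x
    unfolding stage stageS using split uniq by (smt (verit, ccfv_threshold) prod.inject)
  then show ?thesis unfolding h_def by force
qed

lemma cantor_interval_length:
  assumes "(a, b) \<in> cantor_intervals \<alpha> n"
  shows "b - a = (1 / 2) ^ n * (\<Prod>k = 1..n. 1 - \<alpha> k)"
  using assms
proof (induction n arbitrary: a b)
  case (Suc n)
  then obtain c d where cd: "(c, d) \<in> cantor_intervals \<alpha> n"
    and ab: "(a, b) = (c, (c + d) / 2 - \<alpha> (Suc n) * (d - c) / 2) \<or>
      (a, b) = ((c + d) / 2 + \<alpha> (Suc n) * (d - c) / 2, d)" by auto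
  from ab have "b - a = (1 - \<alpha> (Suc n)) * (d - c) / 2" by (auto simp: field_simps)
  then show ?case using Suc.IH[OF cd] by simp
qed auto

lemma cantor_gap_length:
  assumes "(a, b) \<in> cantor_intervals \<alpha> n"
  shows "\<alpha> (Suc n) * (b - a) = gap_length \<alpha> (Suc n)"
  using cantor_interval_length[OF assms] by (simp add: gap_length_def)


section \<open>Fourier transform\<close>

definition fourier_transform :: "(real \<Rightarrow> complex) \<Rightarrow> real \<Rightarrow> complex" where
  "fourier_transform g \<xi> =
     (LINT x|lborel. g x * exp (- 2 * complex_of_real pi * \<i> * complex_of_real (x * \<xi>)))"

definition fourier_kernel :: "real set \<Rightarrow> real \<Rightarrow> real \<Rightarrow> complex" where
  "fourier_kernel M x y = fourier_transform (indicator M) (x - y)"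


section \<open>Configurations and point processes\<close>

text \<open>The configuration \<open>\<Sum>\<^sub>i \<delta>\<^bsub>x\<^sub>i\<^esub>\<close> is represented by its multiplicity function
  \<open>x \<mapsto> card {i. x\<^sub>i = x}\<close>.\<close>

typedef config = "{m :: real \<Rightarrow> nat. \<forall>\<Delta>. compact \<Delta> \<longrightarrow> finite {x \<in> \<Delta>. m x \<noteq> 0}}"
  morphisms multiplicity Config
  by (rule exI[of _ "\<lambda>_. 0"]) simp

definition config_measure :: "config \<Rightarrow> real measure" where
  "config_measure X = density (count_space UNIV) (\<lambda>x. of_nat (multiplicity X x))"

definition config_points :: "config \<Rightarrow> real set" where
  "config_points X = {x. multiplicity X x \<noteq> 0}"

definition config_count :: "real set \<Rightarrow> config \<Rightarrow> ennreal" where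
  "config_count B X = emeasure (config_measure X) B"

definition simple_config :: "config \<Rightarrow> bool" where
  "simple_config X \<longleftrightarrow> (\<forall>x. config_count {x} X \<le> 1)"

text \<open>The vague topology.\<close>

instantiation config :: topological_space
begin

definition open_config :: "config set \<Rightarrow> bool" where
  "open_config = generate_topology
     {(\<lambda>X. integral\<^sup>L (config_measure X) f) -` U | (f :: real \<Rightarrow> real) U.
        continuous_on UNIV f \<and> compact (closure {x. f x \<noteq> 0}) \<and> open U}"

instance
  by standard (auto simp: open_config_def intro: generate_topology.intros)

end

definition point_process :: "config measure \<Rightarrow> bool" where
  "point_process P \<longleftrightarrow> prob_space P \<and> sets P = sets borel"

definition simple_point_process :: "config measure \<Rightarrow> bool" where
  "simple_point_process P \<longleftrightarrow> point_process P \<and> (AE X in P. simple_config X)"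


section \<open>Determinantal point processes\<close>

text \<open>Points of \<open>\<real>\<^sup>n\<close> are extensional functions on \<open>{..<n}\<close>.\<close>

definition bounded_compactly_supported_measurable ::
    "nat \<Rightarrow> ((nat \<Rightarrow> real) \<Rightarrow> complex) \<Rightarrow> bool" where
  "bounded_compactly_supported_measurable n \<phi> \<longleftrightarrow>
     \<phi> \<in> borel_measurable (\<Pi>\<^sub>M i\<in>{..<n}. lborel) \<and>
     bounded (\<phi> ` ({..<n} \<rightarrow>\<^sub>E UNIV)) \<and>
     (\<exists>\<Delta>. compact \<Delta> \<and> (\<forall>x \<in> {..<n} \<rightarrow>\<^sub>E UNIV. \<phi> x \<noteq> 0 \<longrightarrow> x \<in> {..<n} \<rightarrow>\<^sub>E \<Delta>))"

text \<open>For a locally finite configuration and compactly supported \<open>\<phi>\<close> only finitely many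
  terms of this sum are nonzero.\<close>

definition distinct_tuple_sum :: "nat \<Rightarrow> ((nat \<Rightarrow> real) \<Rightarrow> complex) \<Rightarrow> config \<Rightarrow> complex" where
  "distinct_tuple_sum n \<phi> X =
     (\<Sum>\<^sub>\<infinity>x \<in> {x \<in> {..<n} \<rightarrow>\<^sub>E config_points X. inj_on x {..<n}}. \<phi> x)"

text \<open>Integrability of both sides is stated explicitly, because the Bochner integral of a
  non-integrable function is 0.\<close>

definition determinantal_process :: "config measure \<Rightarrow> (real \<Rightarrow> real \<Rightarrow> complex) \<Rightarrow> bool" where
  "determinantal_process P K \<longleftrightarrow> simple_point_process P \<and>
     (\<forall>n \<ge> 1. \<forall>\<phi>. bounded_compactly_supported_measurable n \<phi> \<longrightarrow>
        (let rhs = (\<lambda>x. \<phi> x * Determinant.det (Matrix.mat n n (\<lambda>(i, j). K (x i) (x j)))) in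
          integrable P (distinct_tuple_sum n \<phi>) \<and>
          integrable (\<Pi>\<^sub>M i\<in>{..<n}. lborel) rhs \<and>
          integral\<^sup>L P (distinct_tuple_sum n \<phi>) = integral\<^sup>L (\<Pi>\<^sub>M i\<in>{..<n}. lborel) rhs))"


section \<open>Number rigidity\<close>

definition counting_algebra :: "real set \<Rightarrow> config measure" where
  "counting_algebra S = sigma UNIV
     {config_count B -` A | B A. B \<in> sets borel \<and> B \<subseteq> S \<and> A \<in> sets borel}"

text \<open>The completion adjoins all subsets of \<open>P\<close>-null sets of the full Borel \<open>\<sigma>\<close>-algebra on
  configurations. Adjoining only the subsets of null sets in \<open>counting_algebra S\<close> would make
  rigidity impossible: a set in \<open>counting_algebra (- B)\<close> does not constrain the
  configuration inside \<open>B\<close>.\<close>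

definition completed_counting_algebra :: "config measure \<Rightarrow> real set \<Rightarrow> config measure" where
  "completed_counting_algebra P S =
     sigma UNIV (sets (counting_algebra S) \<union> null_sets (completion P))"

definition number_rigid :: "config measure \<Rightarrow> bool" where
  "number_rigid P \<longleftrightarrow>
     (\<forall>B. compact B \<longrightarrow> config_count B \<in> borel_measurable (completed_counting_algebra P (- B)))"

end

theory Submission
  imports Defs "HOL-Real_Asymp.Real_Asymp"
begin

text \<open>By an argument of Ghosh and Peres, a point process is number rigid as soon as, for all \<open>R\<close> and
  \<open>e > 0\<close>, some test function equal to 1 on \<open>[-R, R]\<close> has a linear statistic of variance at most \<open>e\<close>.
  Let \<open>h\<close> be the Fourier transform of the indicator of \<open>A\<close>. For the kernel \<open>h(x - y)\<close>, Plancherel's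
  identity bounds the variance of the statistic of \<open>f\<close> by half the integral over \<open>t\<close> of
  \<open>|h(t)|\<^sup>2 \<parallel>f(\<cdot> + t) - f\<parallel>\<^sup>2\<close>. A gap of length \<open>l\<close> contributes at most \<open>min(l, 1/(\<pi>|t|))\<close>
  to \<open>|h(t)|\<close>, so the hypothesis on the gap lengths yields
  \<open>|h(t)|\<^sup>2 \<le> D (1 + log |t|)\<^sup>\<theta> / t\<^sup>2\<close> with \<open>\<theta> < 1\<close>. The average \<open>f\<close> of \<open>M\<close> cutoff functions
  at the scales \<open>4\<^sup>m\<close>, \<open>M \<le> m < 2M\<close>, satisfies
  \<open>\<parallel>f(\<cdot> + t) - f\<parallel>\<^sup>2 \<le> C min(|t|, 16\<^sup>M) / M\<^sup>2\<close>, which makes the energy of order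
  \<open>M\<close> to the power \<open>\<theta> - 1\<close>.\<close>

section \<open>Fourier transforms of indicator functions\<close>

text \<open>A decay of exactly \<open>1 / t\<^sup>2\<close> is borderline. For a single cutoff at
  scale L the squared increment is of order min(t^2 / L, L), and its energy stays of order 1 however
  large L is. Spreading the descent over M scales makes each |t| feel essentially one scale, so the
  energy of the average drops to order 1/M; a factor (1 + log |t|)^\<theta> in the decay costs
  M^\<theta>, hence the need for \<theta> < 1. The hypothesis has the matching form. It forces l_n
  \<le> exp(-4^(n/\<delta>)) for large n, so such a gap is longer than 1/|t| only if 4^(n/\<delta>)
  \<le> log |t|, that is 2^n \<le> (log |t|)^(\<delta>/2). Each of these gaps contributes at most
  1/(pi |t|), which suggests the exponent \<delta> after squaring. The proof settles for \<theta> =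
  (1 + \<delta>)/2, between \<delta> and 1, so that a geometric series converges. C and I are
  treated together: their transforms add up to that of [0,1], which is O(1/|t|).\<close>

lemma fourier_integrable:
  assumes "M \<in> sets borel" "emeasure lborel M < \<infinity>"
  shows "integrable lborel (\<lambda>x. indicator M x * exp (- 2 * complex_of_real pi * \<i> * complex_of_real (x * \<xi>)))"
proof (rule Bochner_Integration.integrable_bound)
  show "integrable lborel (indicator M :: real \<Rightarrow> real)"
    using assms by (intro integrable_real_indicator) auto
qed (use assms(1) in \<open>auto simp: norm_mult indicator_def\<close>)

lemma norm_fourier_indicator_le:
  assumes "M \<in> sets borel" "emeasure lborel M < \<infinity>"
  shows "norm (fourier_transform (indicator M) \<xi>) \<le> measure lborel M"
proof -
  have "norm (fourier_transform (indicator M) \<xi>) \<le>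
      (\<integral>x. norm (indicator M x * exp (- 2 * complex_of_real pi * \<i> * complex_of_real (x * \<xi>))) \<partial>lborel)"
    unfolding fourier_transform_def by (rule integral_norm_bound)
  also have "\<dots> = (\<integral>x. indicator M x \<partial>lborel)"
    by (intro Bochner_Integration.integral_cong) (auto simp: norm_mult indicator_def)
  finally show ?thesis using assms by simp
qed

lemma fourier_indicator_0:
  assumes "M \<in> sets borel" "emeasure lborel M < \<infinity>"
  shows "fourier_transform (indicator M) 0 = of_real (measure lborel M)"
proof -
  have "fourier_transform (indicator M) 0 = (\<integral>x. complex_of_real (indicator M x) \<partial>lborel)"
    unfolding fourier_transform_def by (intro Bochner_Integration.integral_cong) (auto simp: indicator_def)
  then show ?thesis using assms by (simp only: integral_complex_of_real) simp
qed

text \<open>The indicator is real-valued. This makes the kernel Hermitian and the squared modulus of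
  the transform even.\<close>

lemma fourier_indicator_uminus:
  "fourier_transform (indicator M) (- \<xi>) = cnj (fourier_transform (indicator M) \<xi>)"
  unfolding fourier_transform_def Bochner_Integration.integral_cnj[symmetric]
  by (intro Bochner_Integration.integral_cong) (auto simp: indicator_def exp_cnj)

lemma fourier_indicator_measurable:
  assumes [measurable]: "M \<in> sets borel"
  shows "fourier_transform (indicator M) \<in> borel_measurable borel"
  unfolding fourier_transform_def[abs_def] by measurable

lemma fourier_indicator_diff:
  assumes M: "M \<in> sets borel" "emeasure lborel M < \<infinity>" and N: "N \<in> sets borel" "N \<subseteq> M"
  shows "fourier_transform (indicator (M - N)) \<xi> =
    fourier_transform (indicator M) \<xi> - fourier_transform (indicator N) \<xi>"
proof -
  have "emeasure lborel N \<le> emeasure lborel M" using M N by (intro emeasure_mono) auto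
  then have "emeasure lborel N < \<infinity>" using M by (auto simp: less_top[symmetric] top_unique)
  note int = fourier_integrable[OF M, of \<xi>] fourier_integrable[OF N(1) this, of \<xi>]
  show ?thesis
    unfolding fourier_transform_def Bochner_Integration.integral_diff[OF int, symmetric]
    using N by (intro Bochner_Integration.integral_cong) (auto simp: indicator_def)
qed

lemma fourier_indicator_UN_disjoint:
  assumes "finite I" "disjoint_family_on A I" "\<And>i. i \<in> I \<Longrightarrow> A i \<in> sets borel"
    "\<And>i. i \<in> I \<Longrightarrow> emeasure lborel (A i) < \<infinity>"
  shows "fourier_transform (indicator (\<Union>i\<in>I. A i)) \<xi> = (\<Sum>i\<in>I. fourier_transform (indicator (A i)) \<xi>)"
proof -
  have "indicator (\<Union>i\<in>I. A i) x = (\<Sum>i\<in>I. indicator (A i) x :: complex)" for x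
    using assms(1,2) by (rule indicator_UN_disjoint)
  then show ?thesis
    unfolding fourier_transform_def
    by (simp only: sum_distrib_right) (intro Bochner_Integration.integral_sum fourier_integrable assms(3,4))
qed

lemma emeasure_lborel_Ioo_finite: "emeasure lborel {a<..<b::real} < \<infinity>"
  by (cases "a \<le> b") auto

text \<open>The antiderivative \<open>?F\<close> has modulus
  \<open>1 / (2 * pi * \<bar>\<xi>\<bar>)\<close> at both endpoints, so the length of the interval
  drops out.\<close>

lemma norm_fourier_Icc_le:
  assumes "a \<le> b" "\<xi> \<noteq> 0"
  shows "norm (fourier_transform (indicator {a..b}) \<xi>) \<le> 1 / (pi * \<bar>\<xi>\<bar>)"
proof -
  let ?c = "- 2 * complex_of_real pi * \<i> * complex_of_real \<xi>"
  let ?F = "\<lambda>x :: real. exp (?c * complex_of_real x) / ?c"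
  have c: "?c \<noteq> 0" using assms(2) by simp
  have "fourier_transform (indicator {a..b}) \<xi> =
      (\<integral>x. indicator {a..b} x *\<^sub>R exp (?c * complex_of_real x) \<partial>lborel)"
    unfolding fourier_transform_def
    by (intro Bochner_Integration.integral_cong) (auto simp: indicator_def mult_ac)
  also have "\<dots> = ?F b - ?F a"
  proof (rule integral_FTC_atLeastAtMost[OF assms(1)])
    show "(?F has_vector_derivative exp (?c * complex_of_real x)) (at x within {a..b})" for x
    proof -
      have "((\<lambda>z. exp (?c * z) / ?c) has_field_derivative exp (?c * complex_of_real x)) (at (complex_of_real x))"
        using c by (auto intro!: derivative_eq_intros simp: field_simps)
      from has_vector_derivative_real_field[OF this] show ?thesis .
    qed
  qed (intro continuous_intros)
  also have "norm \<dots> \<le> norm (?F b) + norm (?F a)" by (rule norm_triangle_ineq4)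
  also have "\<dots> = 1 / (pi * \<bar>\<xi>\<bar>)" by (simp add: norm_divide norm_mult)
  finally show ?thesis .
qed

lemma fourier_indicator_cong_AE:
  assumes "M \<in> sets borel" "N \<in> sets borel" "AE x in lborel. x \<in> M \<longleftrightarrow> x \<in> N"
  shows "fourier_transform (indicator M) \<xi> = fourier_transform (indicator N) \<xi>"
  unfolding fourier_transform_def
proof (rule integral_cong_AE)
  show "AE x in lborel. indicator M x * exp (- 2 * complex_of_real pi * \<i> * complex_of_real (x * \<xi>)) =
      indicator N x * exp (- 2 * complex_of_real pi * \<i> * complex_of_real (x * \<xi>))"
    using assms(3) by eventually_elim (simp add: indicator_def)
qed (use assms in measurable)

lemma norm_fourier_Ioo_le:
  assumes "a \<le> b" "\<xi> \<noteq> 0"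
  shows "norm (fourier_transform (indicator {a<..<b}) \<xi>) \<le> min (b - a) (1 / (pi * \<bar>\<xi>\<bar>))"
proof -
  have "AE x in lborel. x \<noteq> a" "AE x in lborel. x \<noteq> b" by (rule AE_lborel_singleton)+
  then have "AE x in lborel. x \<in> {a<..<b} \<longleftrightarrow> x \<in> {a..b}" by eventually_elim auto
  then have eq: "fourier_transform (indicator {a<..<b}) \<xi> = fourier_transform (indicator {a..b}) \<xi>"
    by (intro fourier_indicator_cong_AE) auto
  have "norm (fourier_transform (indicator {a..b}) \<xi>) \<le> measure lborel {a..b}"
    using assms by (intro norm_fourier_indicator_le) (auto simp: emeasure_lborel_Icc_eq)
  then show ?thesis unfolding eq using norm_fourier_Icc_le[OF assms] assms(1) by simp
qed

section \<open>Plancherel's inequality for indicators, by Gaussian damping\<close>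

text \<open>Domination by a product of integrable functions of one variable; this justifies the
  Fubini exchanges in \<open>gaussian_fourier_energy\<close> and
  \<open>energy_identity\<close>.\<close>

lemma integrable_pair_bound:
  fixes h :: "real \<Rightarrow> real \<Rightarrow> 'b :: {banach, second_countable_topology}"
  assumes f: "integrable lborel f" and g: "integrable lborel g"
    and [measurable]: "case_prod h \<in> borel_measurable (borel \<Otimes>\<^sub>M borel)"
    and h: "\<And>x y. norm (h x y) \<le> f x * g y"
  shows "integrable (lborel \<Otimes>\<^sub>M lborel) (case_prod h)"
proof (rule Bochner_Integration.integrable_bound)
  have [measurable]: "f \<in> borel_measurable borel" "g \<in> borel_measurable borel"
    using borel_measurable_integrable[OF f] borel_measurable_integrable[OF g] by simp_all
  show "integrable (lborel \<Otimes>\<^sub>M lborel) (\<lambda>(x, y). f x * g y)"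
    by (rule lborel_pair.Fubini_integrable) (use f g in \<open>auto simp: abs_mult\<close>)
  show "AE z in lborel \<Otimes>\<^sub>M lborel. norm (case_prod h z) \<le> norm (case z of (x, y) \<Rightarrow> f x * g y)"
    by (rule AE_I2) (use h in \<open>fastforce intro: order_trans\<close>)
qed measurable

text \<open>Continuity of translation at 0, from regularity of Lebesgue measure. Take T compact
  inside M and U open around T, each approximating to within e/2. If |h| is less than the distance
  by which U surrounds T, the translate \<open>T'\<close> of T stays in U, so it loses less than e/2
  outside T; and \<open>T' \<inter> T\<close> lies in the set to be measured.\<close>

lemma measure_Int_translate_ge:
  fixes M :: "real set"
  assumes M: "M \<in> sets borel" "bounded M" and e: "0 < e"
  shows "\<exists>d>0. \<forall>h. \<bar>h\<bar> < d \<longrightarrow> measure lborel M - e \<le> measure lborel {x \<in> M. x + h \<in> M}"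
proof -
  have fin: "emeasure lborel A < \<infinity>" if "A \<subseteq> B" "bounded B" for A B :: "real set"
    using that bounded_subset emeasure_bounded_finite by blast
  \<comment> \<open>Inner regularity of M is obtained as outer regularity of its complement:
    \<open>T = - V\<close> is then closed, and compact because M is bounded.\<close>
  from M(1) e obtain V where V: "open V" "- M \<subseteq> V" "emeasure lborel (V - (- M)) < ennreal (e / 2)"
    using outer_regular_lborel[of "- M" "e / 2"] by auto
  define T where "T = - V"
  have T: "T \<subseteq> M" "closed T" using V by (auto simp: T_def)
  have "bounded T" using T(1) M(2) by (rule bounded_subset[rotated])
  then have cT: "compact T" using T(2) by (simp add: compact_eq_bounded_closed)
  have T_borel [measurable]: "T \<in> sets borel" using T(2) by (rule borel_closed)
  have "V - (- M) = M - T" by (auto simp: T_def)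
  then have "emeasure lborel (M - T) < ennreal (e / 2)" using V(3) by simp
  moreover have "emeasure lborel (M - T) = ennreal (measure lborel (M - T))"
    using fin[of "M - T" M] M(2) by (intro emeasure_eq_ennreal_measure) auto
  ultimately have MT: "measure lborel (M - T) < e / 2" using e by (simp add: ennreal_less_iff)
  have MT': "measure lborel (M - T) = measure lborel M - measure lborel T"
    using M(1) T(1) fin[of M M] M(2) by (intro measure_Diff) auto
  obtain U where U: "open U" "T \<subseteq> U" "emeasure lborel (U - T) < ennreal (e / 2)"
    using outer_regular_lborel[OF T_borel, of "e / 2"] e by auto
  have U_borel [measurable]: "U \<in> sets borel" using U(1) by (rule borel_open)
  have "emeasure lborel (U - T) = ennreal (measure lborel (U - T))"
    using U(3) by (intro emeasure_eq_ennreal_measure) auto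
  then have UT: "measure lborel (U - T) < e / 2" using U(3) e by (simp add: ennreal_less_iff)
  from compact_subset_open_imp_ball_epsilon_subset[OF cT U(1,2)] obtain d
    where d: "d > 0" "(\<Union>x\<in>T. ball x d) \<subseteq> U" by blast
  show ?thesis
  proof (intro exI[of _ d] conjI allI impI)
    fix h :: real assume h: "\<bar>h\<bar> < d"
    define T' where "T' = {x. x + h \<in> T}"
    have [measurable]: "T' \<in> sets borel" unfolding T'_def by measurable
    have T'_eq: "T' = (\<lambda>x. - h + x) ` T" by (force simp: T'_def image_iff)
    have "T' \<subseteq> U"
    proof
      fix x assume "x \<in> T'"
      then have "x + h \<in> T" by (simp add: T'_def)
      moreover have "x \<in> ball (x + h) d" using h by (simp add: dist_real_def)
      ultimately show "x \<in> U" using d(2) by blast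
    qed
    have finT': "emeasure lborel T' < \<infinity>"
      using \<open>bounded T\<close> unfolding T'_eq by (intro emeasure_bounded_finite bounded_translation)
    have mT': "measure lborel T' = measure lborel T"
    proof -
      have "measure lborel T' = (\<integral>x. indicator T' x \<partial>lborel)" using finT' by simp
      also have "\<dots> = (\<integral>x. indicator T (h + 1 * x) \<partial>lborel)"
        by (intro Bochner_Integration.integral_cong) (auto simp: T'_def indicator_def add.commute)
      also have "\<dots> = measure lborel T"
        using lborel_integral_real_affine[of 1 "indicator T :: real \<Rightarrow> real" h] by simp
      finally show ?thesis .
    qed
    have "measure lborel (T' - T) \<le> measure lborel (U - T)"
    proof (rule measure_mono_fmeasurable)
      show "U - T \<in> fmeasurable lborel"
        using less_trans[OF U(3) ennreal_less_top] by (intro fmeasurableI) auto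
    qed (use \<open>T' \<subseteq> U\<close> in auto)
    moreover have "measure lborel (T' - T) = measure lborel T' - measure lborel (T' \<inter> T)"
    proof -
      have "T' - T = T' - (T' \<inter> T)" by blast
      moreover have "measure lborel (T' - (T' \<inter> T)) = measure lborel T' - measure lborel (T' \<inter> T)"
        using finT' by (intro measure_Diff) auto
      ultimately show ?thesis by (simp only:)
    qed
    moreover have "measure lborel (T' \<inter> T) \<le> measure lborel {x \<in> M. x + h \<in> M}"
    proof (rule measure_mono_fmeasurable)
      have [measurable]: "M \<in> sets borel" by (rule M(1))
      have "{x. x \<in> M \<and> x + h \<in> M} \<in> sets borel" by measurable
      then show "{x \<in> M. x + h \<in> M} \<in> fmeasurable lborel"
        using fin[of "{x \<in> M. x + h \<in> M}" M] M(2) by (intro fmeasurableI) auto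
    qed (use T(1) in \<open>auto simp: T'_def\<close>)
    ultimately show "measure lborel M - e \<le> measure lborel {x \<in> M. x + h \<in> M}"
      using MT MT' UT mT' by linarith
  qed (rule d(1))
qed

text \<open>The characteristic function of the standard normal law at \<open>- h / \<tau>\<close>,
  after the substitution \<open>x = 2 * pi * \<tau> * \<xi>\<close>. The damping factor is scaled so
  that its transform is a probability density of standard deviation \<open>\<tau>\<close>, an
  approximate identity as \<open>\<tau>\<close> tends to 0.\<close>

lemma fourier_gaussian:
  assumes "0 < \<tau>"
  shows "(\<integral>\<xi>. complex_of_real (exp (- (2 * pi * \<tau> * \<xi>)\<^sup>2 / 2)) * exp (- 2 * complex_of_real pi * \<i> * complex_of_real (h * \<xi>)) \<partial>lborel) =
    complex_of_real (normal_density 0 \<tau> h)"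
proof -
  let ?a = "\<lambda>\<xi>. complex_of_real (exp (- (2 * pi * \<tau> * \<xi>)\<^sup>2 / 2)) * exp (- 2 * complex_of_real pi * \<i> * complex_of_real (h * \<xi>))"
  let ?f = "\<lambda>x. std_normal_density x *\<^sub>R iexp (- h / \<tau> * x)"
  have eq: "?f (0 + 2 * pi * \<tau> * \<xi>) = complex_of_real (1 / sqrt (2 * pi)) * ?a \<xi>" for \<xi>
    using assms by (simp add: std_normal_density_def scaleR_conv_of_real mult_ac)
  have "complex_of_real (exp (- ((- h / \<tau>)\<^sup>2) / 2)) = char std_normal_distribution (- h / \<tau>)"
    by (simp add: char_std_normal_distribution)
  also have "\<dots> = (\<integral>x. ?f x \<partial>lborel)"
    unfolding char_def by (subst integral_density) (auto simp del: of_real_mult)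
  also have "\<dots> = \<bar>2 * pi * \<tau>\<bar> *\<^sub>R (\<integral>\<xi>. ?f (0 + 2 * pi * \<tau> * \<xi>) \<partial>lborel)"
    using assms by (intro lborel_integral_real_affine) auto
  also have "\<dots> = \<bar>2 * pi * \<tau>\<bar> *\<^sub>R (complex_of_real (1 / sqrt (2 * pi)) * (\<integral>\<xi>. ?a \<xi> \<partial>lborel))"
    unfolding eq by (simp only: integral_mult_right_zero)
  also have "\<dots> = complex_of_real (2 * pi * \<tau> / sqrt (2 * pi)) * (\<integral>\<xi>. ?a \<xi> \<partial>lborel)"
    using assms by (simp add: scaleR_conv_of_real)
  also have "2 * pi * \<tau> / sqrt (2 * pi) = sqrt (2 * pi) * \<tau>"
  proof -
    have "2 * pi / sqrt (2 * pi) = sqrt (2 * pi)" by (rule real_div_sqrt) simp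
    then have "2 * pi / sqrt (2 * pi) * \<tau> = sqrt (2 * pi) * \<tau>" by (simp only:)
    then show ?thesis by (simp only: times_divide_eq_left)
  qed
  finally have E: "complex_of_real (exp (- ((- h / \<tau>)\<^sup>2) / 2)) =
      complex_of_real (sqrt (2 * pi) * \<tau>) * (\<integral>\<xi>. ?a \<xi> \<partial>lborel)" .
  have ne: "complex_of_real (sqrt (2 * pi) * \<tau>) \<noteq> 0" using assms by simp
  have "(\<integral>\<xi>. ?a \<xi> \<partial>lborel) =
      complex_of_real (exp (- ((- h / \<tau>)\<^sup>2) / 2)) / complex_of_real (sqrt (2 * pi) * \<tau>)"
    unfolding E by (rule nonzero_mult_div_cancel_left[OF ne, symmetric])
  also have "\<dots> = complex_of_real (exp (- ((- h / \<tau>)\<^sup>2) / 2) / (sqrt (2 * pi) * \<tau>))"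
    by (simp only: of_real_divide)
  also have "exp (- ((- h / \<tau>)\<^sup>2) / 2) / (sqrt (2 * pi) * \<tau>) = normal_density 0 \<tau> h"
  proof -
    have "sqrt (2 * pi * \<tau>\<^sup>2) = sqrt (2 * pi) * \<tau>" using assms by (simp add: real_sqrt_mult)
    moreover have "- ((- h / \<tau>)\<^sup>2) / 2 = - (h - 0)\<^sup>2 / (2 * \<tau>\<^sup>2)" by (simp add: power_divide)
    ultimately show ?thesis unfolding normal_density_def by simp
  qed
  finally show ?thesis .
qed

text \<open>Write the squared modulus as a double integral over M and integrate over
  \<open>\<xi>\<close> first. The Gaussian supplies the absolute convergence in \<open>\<xi>\<close>
  on which the exchange of integrals rests.\<close>

lemma gaussian_fourier_energy:
  assumes M [measurable]: "M \<in> sets borel" and bM: "bounded M" and \<tau>: "0 < \<tau>"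
  shows "(\<integral>\<xi>. exp (- (2 * pi * \<tau> * \<xi>)\<^sup>2 / 2) * (norm (fourier_transform (indicator M) \<xi>))\<^sup>2 \<partial>lborel) =
    (\<integral>h. normal_density 0 \<tau> h * measure lborel {x \<in> M. x + h \<in> M} \<partial>lborel)"
    and "integrable lborel (\<lambda>h. normal_density 0 \<tau> h * measure lborel {x \<in> M. x + h \<in> M})"
proof -
  let ?F = "fourier_transform (indicator M)"
  let ?e = "\<lambda>x \<xi>. exp (- 2 * complex_of_real pi * \<i> * complex_of_real (x * \<xi>))"
  let ?a = "\<lambda>\<xi>. exp (- (2 * pi * \<tau> * \<xi>)\<^sup>2 / 2)"
  let ?\<chi> = "indicator M :: real \<Rightarrow> complex"
  let ?n = "normal_density 0 \<tau>"
  have fin: "emeasure lborel M < \<infinity>" using bM by (rule emeasure_bounded_finite)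
  have F_le: "norm (?F \<xi>) \<le> measure lborel M" for \<xi> using M fin by (rule norm_fourier_indicator_le)
  have [measurable]: "?F \<in> borel_measurable borel" using M by (rule fourier_indicator_measurable)
  have [measurable]: "cnj \<in> borel_measurable borel"
    by (intro borel_measurable_continuous_onI continuous_intros)
  have int_M: "integrable lborel (indicator M :: real \<Rightarrow> real)" using fin by (intro integrable_real_indicator) auto
  have int_a: "integrable lborel ?a"
  proof -
    let ?s = "1 / (2 * pi * \<tau>)"
    have eq: "?a = (\<lambda>\<xi>. sqrt (2 * pi * ?s\<^sup>2) * normal_density 0 ?s \<xi>)"
      using \<tau> by (intro ext) (simp add: normal_density_def field_simps power_mult_distrib)
    show ?thesis
      unfolding eq by (intro integrable_mult_right integrable_normal_density) (use \<tau> in simp)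
  qed
  have norm_e: "norm (?e x \<xi>) = 1" for x \<xi> by simp
  have cnj_F: "cnj (?F \<xi>) = (\<integral>y. ?\<chi> y * ?e (- y) \<xi> \<partial>lborel)" for \<xi>
    using fourier_indicator_uminus[of M \<xi>] unfolding fourier_transform_def[of _ "- \<xi>"] by simp
  \<comment> \<open>Fubini is applied to two variables at a time: \<open>?h1\<close> exchanges
    \<open>\<xi>\<close> with x, and then, for fixed x, \<open>?h2 x\<close> exchanges
    \<open>\<xi>\<close> with the variable y that comes from expanding
    \<open>cnj (?F \<xi>)\<close>.\<close>
  let ?h1 = "\<lambda>\<xi> x. ?\<chi> x * (complex_of_real (?a \<xi>) * cnj (?F \<xi>) * ?e x \<xi>)"
  let ?h2 = "\<lambda>x \<xi> y. ?\<chi> x * (?\<chi> y * (complex_of_real (?a \<xi>) * ?e (x - y) \<xi>))"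
  have I1: "integrable (lborel \<Otimes>\<^sub>M lborel) (case_prod ?h1)"
  proof (rule integrable_pair_bound[OF integrable_mult_right[OF int_a, of "measure lborel M"] int_M])
    show "norm (?h1 \<xi> x) \<le> measure lborel M * ?a \<xi> * indicator M x" for \<xi> x
      using F_le[of \<xi>] by (auto simp: norm_mult indicator_def mult.commute)
  qed measurable
  have I2: "integrable (lborel \<Otimes>\<^sub>M lborel) (case_prod (?h2 x))" for x
  proof (rule integrable_pair_bound[OF int_a int_M])
    show "norm (?h2 x \<xi> y) \<le> ?a \<xi> * indicator M y" for \<xi> y
      by (auto simp: norm_mult indicator_def)
  qed measurable
  have "complex_of_real (\<integral>\<xi>. ?a \<xi> * (norm (?F \<xi>))\<^sup>2 \<partial>lborel) =
      (\<integral>\<xi>. complex_of_real (?a \<xi> * (norm (?F \<xi>))\<^sup>2) \<partial>lborel)"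
    by (rule integral_complex_of_real[symmetric])
  also have "\<dots> = (\<integral>\<xi>. (\<integral>x. ?h1 \<xi> x \<partial>lborel) \<partial>lborel)"
  proof (rule Bochner_Integration.integral_cong[OF refl])
    fix \<xi>
    have "complex_of_real (?a \<xi> * (norm (?F \<xi>))\<^sup>2) = complex_of_real (?a \<xi>) * cnj (?F \<xi>) * ?F \<xi>"
      by (simp only: of_real_mult complex_norm_square mult_ac)
    also have "\<dots> = (\<integral>x. complex_of_real (?a \<xi>) * cnj (?F \<xi>) * (?\<chi> x * ?e x \<xi>) \<partial>lborel)"
      by (simp only: integral_mult_right_zero fourier_transform_def[of ?\<chi> \<xi>])
    also have "\<dots> = (\<integral>x. ?h1 \<xi> x \<partial>lborel)" by (simp only: mult_ac)
    finally show "complex_of_real (?a \<xi> * (norm (?F \<xi>))\<^sup>2) = (\<integral>x. ?h1 \<xi> x \<partial>lborel)" .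
  qed
  also have "\<dots> = (\<integral>x. (\<integral>\<xi>. ?h1 \<xi> x \<partial>lborel) \<partial>lborel)"
    by (rule lborel_pair.Fubini_integral[OF I1, symmetric])
  also have "\<dots> = (\<integral>x. (\<integral>\<xi>. (\<integral>y. ?h2 x \<xi> y \<partial>lborel) \<partial>lborel) \<partial>lborel)"
  proof (intro Bochner_Integration.integral_cong[OF refl])
    fix x \<xi>
    have "?h1 \<xi> x = ?\<chi> x * complex_of_real (?a \<xi>) * ?e x \<xi> * (\<integral>y. ?\<chi> y * ?e (- y) \<xi> \<partial>lborel)"
      unfolding cnj_F[symmetric] by (simp only: mult_ac)
    also have "\<dots> = (\<integral>y. ?\<chi> x * complex_of_real (?a \<xi>) * ?e x \<xi> * (?\<chi> y * ?e (- y) \<xi>) \<partial>lborel)"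
      by (simp only: integral_mult_right_zero)
    also have "\<dots> = (\<integral>y. ?h2 x \<xi> y \<partial>lborel)"
    proof (intro Bochner_Integration.integral_cong[OF refl])
      fix y
      have "?e (x - y) \<xi> = ?e x \<xi> * ?e (- y) \<xi>" by (simp add: algebra_simps flip: exp_add)
      then show "?\<chi> x * complex_of_real (?a \<xi>) * ?e x \<xi> * (?\<chi> y * ?e (- y) \<xi>) = ?h2 x \<xi> y"
        by (simp only: mult_ac)
    qed
    finally show "?h1 \<xi> x = (\<integral>y. ?h2 x \<xi> y \<partial>lborel)" .
  qed
  also have "\<dots> = (\<integral>x. (\<integral>y. (\<integral>\<xi>. ?h2 x \<xi> y \<partial>lborel) \<partial>lborel) \<partial>lborel)"
    by (intro Bochner_Integration.integral_cong[OF refl] lborel_pair.Fubini_integral[OF I2, symmetric])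
  also have "\<dots> = (\<integral>x. (\<integral>y. ?\<chi> x * (?\<chi> y * complex_of_real (?n (x - y))) \<partial>lborel) \<partial>lborel)"
    by (simp only: integral_mult_right_zero fourier_gaussian[OF \<tau>])
  also have "\<dots> = (\<integral>x. (\<integral>y. complex_of_real (indicator M x * (indicator M y * ?n (x - y))) \<partial>lborel) \<partial>lborel)"
    by (intro Bochner_Integration.integral_cong[OF refl]) (simp add: indicator_def)
  also have "\<dots> = complex_of_real (\<integral>x. (\<integral>y. indicator M x * (indicator M y * ?n (x - y)) \<partial>lborel) \<partial>lborel)"
    by (simp only: integral_complex_of_real)
  finally have E1: "(\<integral>\<xi>. ?a \<xi> * (norm (?F \<xi>))\<^sup>2 \<partial>lborel) =
      (\<integral>x. (\<integral>y. indicator M x * (indicator M y * ?n (x - y)) \<partial>lborel) \<partial>lborel)"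
    by (simp only: of_real_eq_iff)
  let ?h3 = "\<lambda>x h. indicator M x * (indicator M (x + h) * ?n h) :: real"
  have I3: "integrable (lborel \<Otimes>\<^sub>M lborel) (case_prod ?h3)"
  proof (rule integrable_pair_bound[OF int_M integrable_normal_density[OF \<tau>]])
    show "norm (?h3 x h) \<le> indicator M x * ?n h" for x h
      by (auto simp: indicator_def)
  qed measurable
  have inner: "(\<integral>x. ?h3 x h \<partial>lborel) = ?n h * measure lborel {x \<in> M. x + h \<in> M}" for h
  proof -
    have "(\<integral>x. ?h3 x h \<partial>lborel) = (\<integral>x. ?n h * indicator {x \<in> M. x + h \<in> M} x \<partial>lborel)"
      by (intro Bochner_Integration.integral_cong) (auto simp: indicator_def)
    also have "\<dots> = ?n h * measure lborel {x \<in> M. x + h \<in> M}" by simp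
    finally show ?thesis .
  qed
  note E1
  also have "(\<integral>x. (\<integral>y. indicator M x * (indicator M y * ?n (x - y)) \<partial>lborel) \<partial>lborel) =
      (\<integral>x. (\<integral>h. ?h3 x h \<partial>lborel) \<partial>lborel)"
  proof (rule Bochner_Integration.integral_cong[OF refl])
    fix x
    have "?n (- h) = ?n h" for h by (simp add: normal_density_def)
    then show "(\<integral>y. indicator M x * (indicator M y * ?n (x - y)) \<partial>lborel) = (\<integral>h. ?h3 x h \<partial>lborel)"
      using lborel_integral_real_affine[of 1 "\<lambda>y. indicator M x * (indicator M y * ?n (x - y))" x] by simp
  qed
  also have "\<dots> = (\<integral>h. (\<integral>x. ?h3 x h \<partial>lborel) \<partial>lborel)"
    by (rule lborel_pair.Fubini_integral[OF I3, symmetric])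
  finally show "(\<integral>\<xi>. ?a \<xi> * (norm (?F \<xi>))\<^sup>2 \<partial>lborel) = (\<integral>h. ?n h * measure lborel {x \<in> M. x + h \<in> M} \<partial>lborel)"
    unfolding inner .
  show "integrable lborel (\<lambda>h. ?n h * measure lborel {x \<in> M. x + h \<in> M})"
    using lborel_pair.integrable_snd[OF I3] unfolding inner .
qed

text \<open>Half of Plancherel's identity: damping the left-hand side by a Gaussian turns it into an
  average of \<open>\<bar>M \<inter> (M - h)\<bar>\<close> over \<open>h\<close> near 0.\<close>

lemma measure_le_fourier_energy:
  assumes M: "M \<in> sets borel" "bounded M"
    and int: "integrable lborel (\<lambda>\<xi>. (norm (fourier_transform (indicator M) \<xi>))\<^sup>2)"
  shows "measure lborel M \<le> (\<integral>\<xi>. (norm (fourier_transform (indicator M) \<xi>))\<^sup>2 \<partial>lborel)"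
proof (rule field_le_epsilon)
  fix e :: real assume e: "0 < e"
  let ?E = "\<integral>\<xi>. (norm (fourier_transform (indicator M) \<xi>))\<^sup>2 \<partial>lborel"
  define m where "m = measure lborel M"
  obtain d where d: "0 < d" "\<And>h. \<bar>h\<bar> < d \<Longrightarrow> m - e \<le> measure lborel {x \<in> M. x + h \<in> M}"
    using measure_Int_translate_ge[OF M e] unfolding m_def by blast
  \<comment> \<open>A Chebyshev argument: \<open>(m - e) - m * (h\<^sup>2 / d\<^sup>2)\<close>
    bounds the measure of the intersection from below for every h, by the choice of d if |h| < d and
    because it is negative otherwise. Averaging over h only requires the second moment
    \<open>\<tau>\<^sup>2\<close> of the normal density.\<close>
  have "(m - e) * 1 - m * (1 / d\<^sup>2 * \<tau>\<^sup>2) \<le> ?E" if \<tau>: "0 < \<tau>" for \<tau>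
  proof -
    let ?n = "normal_density 0 \<tau>"
    have sq: "has_bochner_integral lborel (\<lambda>h. ?n h * h\<^sup>2) (\<tau>\<^sup>2)"
      using normal_moment_even[of \<tau> 0 1] \<tau> by (simp add: numeral_2_eq_2)
    have "(m - e) * 1 - m * (1 / d\<^sup>2 * \<tau>\<^sup>2) = (\<integral>h. (m - e) * ?n h - m * (1 / d\<^sup>2 * (?n h * h\<^sup>2)) \<partial>lborel)"
      using has_bochner_integral_integral_eq[OF sq] integrable.intros[OF sq] \<tau>
      by (subst Bochner_Integration.integral_diff) auto
    also have "\<dots> \<le> (\<integral>h. ?n h * measure lborel {x \<in> M. x + h \<in> M} \<partial>lborel)"
    proof (rule integral_mono[OF _ gaussian_fourier_energy(2)[OF M \<tau>]])
      show "integrable lborel (\<lambda>h. (m - e) * ?n h - m * (1 / d\<^sup>2 * (?n h * h\<^sup>2)))"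
        using integrable.intros[OF sq] \<tau> by (intro Bochner_Integration.integrable_diff integrable_mult_right) auto
      show "(m - e) * ?n h - m * (1 / d\<^sup>2 * (?n h * h\<^sup>2)) \<le> ?n h * measure lborel {x \<in> M. x + h \<in> M}" for h
      proof -
        have "(m - e) - m * (h\<^sup>2 / d\<^sup>2) \<le> measure lborel {x \<in> M. x + h \<in> M}"
        proof (cases "\<bar>h\<bar> < d")
          case True
          moreover have "0 \<le> m * (h\<^sup>2 / d\<^sup>2)" by (simp add: m_def)
          ultimately show ?thesis using d(2) by fastforce
        next
          case False
          then have "d\<^sup>2 \<le> h\<^sup>2" using d(1) by (simp add: abs_le_square_iff[symmetric])
          then have "m * 1 \<le> m * (h\<^sup>2 / d\<^sup>2)" using d(1) by (intro mult_left_mono) (auto simp: m_def)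
          moreover have "0 \<le> measure lborel {x \<in> M. x + h \<in> M}" by simp
          ultimately show ?thesis using e by linarith
        qed
        then have "?n h * ((m - e) - m * (h\<^sup>2 / d\<^sup>2)) \<le> ?n h * measure lborel {x \<in> M. x + h \<in> M}"
          by (intro mult_left_mono) auto
        then show ?thesis by (simp add: algebra_simps)
      qed
    qed
    also have "\<dots> = (\<integral>\<xi>. exp (- (2 * pi * \<tau> * \<xi>)\<^sup>2 / 2) * (norm (fourier_transform (indicator M) \<xi>))\<^sup>2 \<partial>lborel)"
      by (rule gaussian_fourier_energy(1)[OF M \<tau>, symmetric])
    also have "\<dots> \<le> ?E"
      using int by (intro integral_mono') (auto intro!: mult_left_le_one_le)
    finally show ?thesis .
  qed
  then have "(m - e) * 1 - m * (1 / d\<^sup>2 * (inverse (real (Suc n)))\<^sup>2) \<le> ?E" for n by simp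
  moreover have "(\<lambda>n. (m - e) * 1 - m * (1 / d\<^sup>2 * (inverse (real (Suc n)))\<^sup>2)) \<longlonglongrightarrow> (m - e) * 1 - m * (1 / d\<^sup>2 * 0\<^sup>2)"
    by (intro tendsto_intros LIMSEQ_inverse_real_of_nat)
  ultimately have "(m - e) * 1 - m * (1 / d\<^sup>2 * 0\<^sup>2) \<le> ?E" by (intro LIMSEQ_le_const2) auto
  then show "measure lborel M \<le> ?E + e" by (simp add: m_def)
qed

section \<open>Decay of the Fourier transforms\<close>

locale cantor_ratios =
  fixes \<alpha> :: "nat \<Rightarrow> real"
  assumes alpha: "\<And>n. n \<ge> 1 \<Longrightarrow> 0 < \<alpha> n \<and> \<alpha> n < 1"
begin

abbreviation gap :: "nat \<Rightarrow> real \<times> real \<Rightarrow> real set" where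
  "gap n J \<equiv> {(fst J + snd J) / 2 - \<alpha> (Suc n) * (snd J - fst J) / 2 <..<
    (fst J + snd J) / 2 + \<alpha> (Suc n) * (snd J - fst J) / 2}"

lemma finite_card_cantor_intervals:
  "finite (cantor_intervals \<alpha> n) \<and> card (cantor_intervals \<alpha> n) \<le> 2 ^ n"
proof (induction n)
  case (Suc n)
  let ?S = "\<lambda>(a, b). {(a, (a + b) / 2 - \<alpha> (Suc n) * (b - a) / 2), ((a + b) / 2 + \<alpha> (Suc n) * (b - a) / 2, b)}"
  have "card (\<Union>J\<in>cantor_intervals \<alpha> n. ?S J) \<le> (\<Sum>J\<in>cantor_intervals \<alpha> n. card (?S J))"
    using Suc by (intro card_UN_le) simp
  also have "\<dots> \<le> (\<Sum>J\<in>cantor_intervals \<alpha> n. 2)"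
    by (intro sum_mono) (auto simp: card_insert_if split: prod.splits)
  finally show ?case using Suc by auto
qed simp

lemma gap_subset:
  assumes "J \<in> cantor_intervals \<alpha> n"
  shows "gap n J \<subseteq> {fst J..snd J}" "fst J < snd J" "0 < \<alpha> (Suc n) * (snd J - fst J)"
proof -
  show less: "fst J < snd J"
    using cantor_intervals_less[of \<alpha> "fst J" "snd J" n] alpha assms by simp
  have "\<alpha> (Suc n) * (snd J - fst J) \<le> 1 * (snd J - fst J)"
    using alpha[of "Suc n"] less by (intro mult_right_mono) auto
  then show "gap n J \<subseteq> {fst J..snd J}" by (auto simp: field_simps)
  show "0 < \<alpha> (Suc n) * (snd J - fst J)" using alpha[of "Suc n"] less by simp
qed

lemma gap_length_pos: "0 < gap_length \<alpha> (Suc n)"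
proof -
  have "0 < (\<Prod>k = 1..n. 1 - \<alpha> k)"
    by (rule prod_pos) (use alpha in fastforce)
  then show ?thesis using alpha[of "Suc n"] by (simp add: gap_length_def)
qed

lemma cantor_stage_borel [measurable]: "cantor_stage \<alpha> n \<in> sets borel"
  unfolding cantor_stage_def using finite_card_cantor_intervals[of n]
  by (intro sets.finite_UN) auto

lemma cantor_stage_decseq: "decseq (cantor_stage \<alpha>)"
  by (intro decseq_SucI) (use alpha in \<open>simp add: cantor_stage_Suc\<close>)

lemma cantor_stage_0: "cantor_stage \<alpha> 0 = {0..1}"
  by (simp add: cantor_stage_def)

lemma cantor_stage_subset: "cantor_stage \<alpha> n \<subseteq> {0..1}"
  using decseqD[OF cantor_stage_decseq, of 0 n] by (simp add: cantor_stage_0)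

lemma emeasure_cantor_stage: "emeasure lborel (cantor_stage \<alpha> n) < \<infinity>"
proof -
  have "emeasure lborel (cantor_stage \<alpha> n) \<le> emeasure lborel {0..1::real}"
    by (intro emeasure_mono cantor_stage_subset) auto
  also have "\<dots> < \<infinity>" by (simp add: emeasure_lborel_Icc_eq)
  finally show ?thesis .
qed

lemma cantor_set_eq: "cantor_set \<alpha> = (\<Inter>n. cantor_stage \<alpha> n)"
proof -
  have "cantor_stage \<alpha> 1 \<subseteq> cantor_stage \<alpha> 0" by (rule decseqD[OF cantor_stage_decseq]) simp
  then have "x \<in> cantor_stage \<alpha> n" if "x \<in> (\<Inter>n\<in>{1..}. cantor_stage \<alpha> n)" for x n
  proof (cases n)
    case 0
    have "x \<in> cantor_stage \<alpha> 1" using that by (rule INT_D) simp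
    then show ?thesis using \<open>cantor_stage \<alpha> 1 \<subseteq> cantor_stage \<alpha> 0\<close> 0 by blast
  next
    case (Suc m)
    show ?thesis using that by (rule INT_D) (simp add: Suc)
  qed
  then show ?thesis unfolding cantor_set_def by blast
qed

lemma cantor_set_borel: "cantor_set \<alpha> \<in> sets borel"
  unfolding cantor_set_eq by (intro sets.countable_INT'' cantor_stage_borel countableI_type) auto

lemma cantor_set_subset: "cantor_set \<alpha> \<subseteq> {0..1}"
  using cantor_stage_subset[of 0] by (auto simp: cantor_set_eq)

text \<open>Triangle inequality over the disjoint gaps removed in one step. No cancellation between
  gaps is exploited, so the estimate sees their number and common length but not their
  positions.\<close>

lemma norm_fourier_cantor_stage_step:
  assumes "\<xi> \<noteq> 0"
  shows "norm (fourier_transform (indicator (cantor_stage \<alpha> n)) \<xi> -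
      fourier_transform (indicator (cantor_stage \<alpha> (Suc n))) \<xi>) \<le>
    2 ^ n * min (gap_length \<alpha> (Suc n)) (1 / (pi * \<bar>\<xi>\<bar>))"
proof -
  let ?I = "cantor_intervals \<alpha> n"
  let ?U = "\<Union>J\<in>?I. gap n J"
  let ?m = "min (gap_length \<alpha> (Suc n)) (1 / (pi * \<bar>\<xi>\<bar>))"
  have fin: "finite ?I" "card ?I \<le> 2 ^ n" using finite_card_cantor_intervals by auto
  have U: "?U \<subseteq> cantor_stage \<alpha> n"
    unfolding cantor_stage_def using gap_subset(1) by (fastforce split: prod.splits)
  have U_borel: "?U \<in> sets borel" using fin by (intro sets.finite_UN) auto
  have "cantor_stage \<alpha> (Suc n) = cantor_stage \<alpha> n - ?U"
    using cantor_stage_Suc[of \<alpha> n] alpha by (simp add: case_prod_beta)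
  then have "fourier_transform (indicator (cantor_stage \<alpha> (Suc n))) \<xi> =
      fourier_transform (indicator (cantor_stage \<alpha> n)) \<xi> - fourier_transform (indicator ?U) \<xi>"
    using fourier_indicator_diff[OF cantor_stage_borel emeasure_cantor_stage U_borel U] by simp
  moreover have "fourier_transform (indicator ?U) \<xi> = (\<Sum>J\<in>?I. fourier_transform (indicator (gap n J)) \<xi>)"
  proof (rule fourier_indicator_UN_disjoint[OF fin(1)])
    show "disjoint_family_on (gap n) ?I"
      unfolding disjoint_family_on_def
    proof (intro ballI impI)
      fix J L assume JL: "J \<in> ?I" "L \<in> ?I" "J \<noteq> L"
      then have "snd J < fst L \<or> snd L < fst J"
        using cantor_intervals_disjoint[of \<alpha> "fst J" "snd J" n "fst L" "snd L"] alpha by (simp add: prod_eq_iff)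
      then have "{fst J..snd J} \<inter> {fst L..snd L} = {}" by auto
      then show "gap n J \<inter> gap n L = {}" using gap_subset(1)[OF JL(1)] gap_subset(1)[OF JL(2)] by blast
    qed
  qed (simp_all only: borel_open open_greaterThanLessThan emeasure_lborel_Ioo_finite)
  moreover have "norm (\<Sum>J\<in>?I. fourier_transform (indicator (gap n J)) \<xi>) \<le> (\<Sum>J\<in>?I. ?m)"
  proof (rule sum_norm_le)
    fix J assume J: "J \<in> ?I"
    have len: "\<alpha> (Suc n) * (snd J - fst J) = gap_length \<alpha> (Suc n)"
      using cantor_gap_length[of "fst J" "snd J" \<alpha> n] J by simp
    show "norm (fourier_transform (indicator (gap n J)) \<xi>) \<le> ?m"
      using norm_fourier_Ioo_le[OF _ assms, of "(fst J + snd J) / 2 - \<alpha> (Suc n) * (snd J - fst J) / 2"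
          "(fst J + snd J) / 2 + \<alpha> (Suc n) * (snd J - fst J) / 2"] gap_subset(3)[OF J]
      unfolding len by simp
  qed
  moreover have "(\<Sum>J\<in>?I. ?m) \<le> 2 ^ n * ?m"
  proof -
    have "0 \<le> ?m" using gap_length_pos[of n] by simp
    moreover have "real (card ?I) \<le> 2 ^ n" using fin(2) by (metis of_nat_le_iff of_nat_numeral of_nat_power)
    ultimately show ?thesis by (simp add: mult_right_mono)
  qed
  ultimately show ?thesis by simp
qed

text \<open>Telescoping from stage 0, which is [0,1], and dominated convergence show that S bounds
  the transform of the whole removed part. That part is the complement; the Cantor set costs the
  additional term of [0,1]. The weaker bound is stated for both so that they can share the rest of
  the argument.\<close>

lemma norm_fourier_cantor_le:
  assumes "\<xi> \<noteq> 0"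
    and S: "\<And>N. (\<Sum>n<N. 2 ^ n * min (gap_length \<alpha> (Suc n)) (1 / (pi * \<bar>\<xi>\<bar>))) \<le> S"
  shows "norm (fourier_transform (indicator (cantor_set \<alpha>)) \<xi>) \<le> 1 / (pi * \<bar>\<xi>\<bar>) + S" (is ?C)
    and "norm (fourier_transform (indicator (cantor_complement \<alpha>)) \<xi>) \<le> 1 / (pi * \<bar>\<xi>\<bar>) + S" (is ?I)
proof -
  let ?F = "\<lambda>n. fourier_transform (indicator (cantor_stage \<alpha> n)) \<xi>"
  let ?G = "fourier_transform (indicator (cantor_set \<alpha>)) \<xi>"
  have "norm (?F 0 - ?F N) \<le> S" for N
  proof -
    have "?F 0 - ?F N = (\<Sum>n<N. ?F n - ?F (Suc n))" by (rule sum_lessThan_telescope'[symmetric])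
    also have "norm \<dots> \<le> (\<Sum>n<N. 2 ^ n * min (gap_length \<alpha> (Suc n)) (1 / (pi * \<bar>\<xi>\<bar>)))"
      by (intro sum_norm_le norm_fourier_cantor_stage_step assms(1))
    finally show ?thesis using S[of N] by linarith
  qed
  moreover have "?F \<longlonglongrightarrow> ?G"
    unfolding fourier_transform_def
  proof (rule integral_dominated_convergence)
    show "integrable lborel (indicator {0..1} :: real \<Rightarrow> real)"
      by (intro integrable_real_indicator) (auto simp: emeasure_lborel_Icc_eq)
    show "AE x in lborel. (\<lambda>n. indicator (cantor_stage \<alpha> n) x * exp (- 2 * complex_of_real pi * \<i> * complex_of_real (x * \<xi>)))
        \<longlonglongrightarrow> indicator (cantor_set \<alpha>) x * exp (- 2 * complex_of_real pi * \<i> * complex_of_real (x * \<xi>))"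
      unfolding cantor_set_eq
      by (intro AE_I2 tendsto_mult LIMSEQ_indicator_decseq cantor_stage_decseq tendsto_const)
    show "AE x in lborel. norm (indicator (cantor_stage \<alpha> n) x *
        exp (- 2 * complex_of_real pi * \<i> * complex_of_real (x * \<xi>))) \<le> indicator {0..1} x" for n
      using cantor_stage_subset[of n] by (intro AE_I2) (auto simp: norm_mult indicator_def)
  qed (use cantor_set_borel in measurable)
  then have "(\<lambda>n. norm (?F 0 - ?F n)) \<longlonglongrightarrow> norm (?F 0 - ?G)" by (intro tendsto_intros)
  ultimately have le: "norm (?F 0 - ?G) \<le> S" by (intro LIMSEQ_le_const2) auto
  have F0: "norm (?F 0) \<le> 1 / (pi * \<bar>\<xi>\<bar>)"
    using norm_fourier_Icc_le[OF _ assms(1), of 0 1] by (simp add: cantor_stage_0)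
  have "norm ?G \<le> norm (?F 0) + norm (?F 0 - ?G)"
    using norm_triangle_ineq4[of "?F 0" "?F 0 - ?G"] by simp
  with le F0 show ?C by linarith
  have compl: "fourier_transform (indicator (cantor_complement \<alpha>)) \<xi> = ?F 0 - ?G"
    unfolding cantor_complement_def cantor_stage_0
    by (rule fourier_indicator_diff) (auto simp: cantor_set_borel cantor_set_subset emeasure_lborel_Icc_eq)
  have "0 \<le> 1 / (pi * \<bar>\<xi>\<bar>)" by simp
  then show ?I unfolding compl using le by linarith
qed

end

text \<open>The exponent \<open>\<gamma> = (1 + \<delta>) / 4\<close> is less than \<open>1/2\<close>, but exceeds \<open>\<delta> / 2\<close>, which makes
  \<open>\<Sum>n. 2\<^sup>n / 4 powr (\<gamma> (n + 1) / \<delta>)\<close> converge.\<close>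

lemma truncated_gap_sum_le:
  fixes l :: "nat \<Rightarrow> real"
  assumes delta: "0 < \<delta>" "\<delta> < 1" and l: "\<And>n. 0 < l n"
    and sum: "summable (\<lambda>n. l n powr (1 / 4 powr (real (Suc n) / \<delta>)))"
  shows "\<exists>D\<ge>0. \<forall>N s. (\<Sum>n<N. 2 ^ n * min (l n) (1 / 4 ^ s)) \<le> D * (1 + real s) powr ((1 + \<delta>) / 4) / 4 ^ s"
proof -
  define \<gamma> where "\<gamma> = (1 + \<delta>) / 4"
  define Q where "Q n = 4 powr (real (Suc n) / \<delta>)" for n
  \<comment> \<open>Ratio of the geometric series that remains at the end: 2 is the growth of the
    number of gaps per step, the other factor the decrease of \<open>Q n powr (- \<gamma>)\<close>.
    It is below 1 because \<open>\<gamma>\<close> exceeds \<open>\<delta> / 2\<close>.\<close>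
  define \<rho> where "\<rho> = 2 * 4 powr (- (\<gamma> / \<delta>))"
  have \<gamma>: "0 < \<gamma>" "\<gamma> < 1" "\<delta> / 2 < \<gamma>" using delta by (auto simp: \<gamma>_def)
  have \<rho>: "0 < \<rho>" "\<rho> < 1"
  proof -
    have "4 powr (- (\<gamma> / \<delta>)) < 4 powr (- (1 / 2))"
      using \<gamma> delta by (intro powr_less_mono) (auto simp: field_simps)
    also have "4 powr (- (1 / 2)) = (1 / 2 :: real)"
      by (simp add: powr_minus powr_half_sqrt real_sqrt_four)
    finally show "\<rho> < 1" by (simp add: \<rho>_def)
  qed (simp add: \<rho>_def)
  have Q: "1 \<le> Q n" for n unfolding Q_def using delta by (intro ge_one_powr_ge_zero) auto
  \<comment> \<open>The terms of a convergent series are eventually below \<open>exp (- 1)\<close>;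
    raising this to the power \<open>Q n\<close> makes \<open>l n\<close> doubly exponentially
    small.\<close>
  have "(\<lambda>n. l n powr (1 / Q n)) \<longlonglongrightarrow> 0"
    using summable_LIMSEQ_zero[OF sum] by (simp add: Q_def)
  then have "\<forall>\<^sub>F n in sequentially. l n powr (1 / Q n) < exp (- 1)"
    by (rule order_tendstoD) simp
  then obtain n0 where n0: "\<And>n. n \<ge> n0 \<Longrightarrow> l n powr (1 / Q n) < exp (- 1)"
    by (auto simp: eventually_sequentially)
  have l_le: "l n \<le> exp (- Q n)" if "n \<ge> n0" for n
  proof -
    have "l n = (l n powr (1 / Q n)) powr Q n"
      using Q[of n] l[of n] by (simp add: powr_powr)
    also have "\<dots> \<le> exp (- 1) powr Q n"
      using n0[OF that] Q[of n] by (intro powr_mono2) auto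
    also have "\<dots> = exp (- Q n)" by (simp add: powr_def)
    finally show ?thesis .
  qed
  \<comment> \<open>The finitely many early steps, where \<open>l n\<close> is not controlled, are
    charged the full \<open>1 / 4 ^ s\<close> per gap. All later ones get a weight geometric in n,
    at the price of a power of \<open>1 + s\<close>.\<close>
  have summand: "2 ^ n * min (l n) (1 / 4 ^ s) \<le>
      ((if n < n0 then 2 ^ n else 0) + 2 * \<rho> ^ n) * (1 + real s) powr \<gamma> / 4 ^ s" for n s
  proof (cases "n < n0")
    case True
    have one: "1 \<le> (1 + real s) powr \<gamma>" using \<gamma> by (intro ge_one_powr_ge_zero) auto
    have "2 ^ n * min (l n) (1 / 4 ^ s) \<le> 2 ^ n * 1 / 4 ^ s" by (simp add: min_def divide_simps)
    also have "\<dots> \<le> (2 ^ n + 2 * \<rho> ^ n) * (1 + real s) powr \<gamma> / 4 ^ s"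
      using one \<rho> by (intro divide_right_mono mult_mono) auto
    finally show ?thesis using True by simp
  next
    case False
    define L where "L = real s * ln 4"
    have "ln (4::real) \<le> 2" using ln_realpow[of 2 2] ln_2_less_1 by simp
    then have L: "0 \<le> L" "1 + L \<le> 2 * (1 + real s)"
      unfolding L_def using mult_left_mono[of "ln (4::real)" 2 "real s"] by auto
    have eL: "1 / 4 ^ s = exp (- L)"
      unfolding L_def by (simp add: exp_minus exp_of_nat_mult field_simps)
    \<comment> \<open>Smooth form of the cut at \<open>Q n = L\<close>. Before it the ratio is at
      least 1 and \<open>exp (- L)\<close> suffices; beyond it the exponential gain
      \<open>exp (- (Q n - L))\<close> is weakened to the ratio r, and then to
      \<open>r powr \<gamma>\<close> because r is at most 1. The weak power still decreases
      geometrically in n.\<close>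
    have "min (exp (- Q n)) (exp (- L)) \<le> exp (- L) * ((1 + L) / (1 + Q n)) powr \<gamma>"
    proof (cases "Q n \<le> L")
      case True
      have "1 \<le> ((1 + L) / (1 + Q n)) powr \<gamma>"
        using True Q[of n] \<gamma> by (intro ge_one_powr_ge_zero) auto
      then have "exp (- L) * 1 \<le> exp (- L) * ((1 + L) / (1 + Q n)) powr \<gamma>" by (intro mult_left_mono) auto
      then show ?thesis by linarith
    next
      case False
      define r where "r = (1 + L) / (1 + Q n)"
      have r: "0 < r" "r \<le> 1" using False L by (auto simp: r_def)
      \<comment> \<open>The two sides differ by \<open>L * (Q n - L)\<close>.\<close>
      have "1 + Q n \<le> (1 + L) * (1 + (Q n - L))" using False L by (simp add: algebra_simps mult_mono)
      also have "\<dots> \<le> (1 + L) * exp (Q n - L)" using L by (intro mult_left_mono exp_ge_add_one_self) auto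
      finally have "exp (- (Q n - L)) \<le> r"
        unfolding r_def exp_minus using False L by (simp add: field_simps)
      also have "r \<le> r powr \<gamma>" using powr_mono'[of \<gamma> 1 r] r \<gamma> by simp
      finally have "exp (- L) * exp (- (Q n - L)) \<le> exp (- L) * r powr \<gamma>" by (intro mult_left_mono) auto
      then have "exp (- Q n) \<le> exp (- L) * r powr \<gamma>" by (simp flip: exp_add)
      then show ?thesis unfolding r_def by linarith
    qed
    moreover have "((1 + L) / (1 + Q n)) powr \<gamma> \<le> 2 * (1 + real s) powr \<gamma> * (\<rho> / 2) ^ n"
    proof -
      have "(1 + L) powr \<gamma> \<le> (2 * (1 + real s)) powr \<gamma>" using L \<gamma> by (intro powr_mono2) auto
      also have "\<dots> = 2 powr \<gamma> * (1 + real s) powr \<gamma>" by (subst powr_mult) auto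
      also have "\<dots> \<le> 2 * (1 + real s) powr \<gamma>"
        using powr_mono[of \<gamma> 1 "2::real"] \<gamma> by (intro mult_right_mono) auto
      finally have A: "(1 + L) powr \<gamma> \<le> 2 * (1 + real s) powr \<gamma>" .
      have "(1 + Q n) powr (- \<gamma>) \<le> Q n powr (- \<gamma>)"
        using Q[of n] \<gamma> by (intro powr_mono2') auto
      also have "\<dots> = 4 powr (real (Suc n) / \<delta> * (- \<gamma>))" by (simp only: Q_def powr_powr)
      also have "real (Suc n) / \<delta> * (- \<gamma>) = - (\<gamma> / \<delta>) * real (Suc n)" by simp
      also have "4 powr (- (\<gamma> / \<delta>) * real (Suc n)) \<le> 4 powr (- (\<gamma> / \<delta>) * real n)"
        using \<gamma> delta by (intro powr_mono) (auto simp: field_simps)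
      also have "\<dots> = (4 powr (- (\<gamma> / \<delta>))) powr real n" by (simp only: powr_powr)
      also have "\<dots> = (4 powr (- (\<gamma> / \<delta>))) ^ n" by (rule powr_realpow) simp
      also have "\<dots> = (\<rho> / 2) ^ n" by (simp add: \<rho>_def)
      finally have B: "(1 + Q n) powr (- \<gamma>) \<le> (\<rho> / 2) ^ n" .
      have "((1 + L) / (1 + Q n)) powr \<gamma> = (1 + L) powr \<gamma> * (1 + Q n) powr (- \<gamma>)"
        using L Q[of n] by (subst powr_divide) (auto simp: powr_minus_divide)
      also have "\<dots> \<le> (2 * (1 + real s) powr \<gamma>) * (\<rho> / 2) ^ n" using A B by (intro mult_mono) auto
      finally show ?thesis .
    qed
    ultimately have "min (exp (- Q n)) (exp (- L)) \<le> exp (- L) * (2 * (1 + real s) powr \<gamma> * (\<rho> / 2) ^ n)"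
      by (meson exp_ge_zero mult_left_mono order_trans)
    moreover have "min (l n) (1 / 4 ^ s) \<le> min (exp (- Q n)) (exp (- L))"
      unfolding eL using l_le[of n] False by (intro min.mono) auto
    ultimately have "2 ^ n * min (l n) (1 / 4 ^ s) \<le> 2 ^ n * (exp (- L) * (2 * (1 + real s) powr \<gamma> * (\<rho> / 2) ^ n))"
      by (intro mult_left_mono) auto
    also have "\<dots> = 2 * \<rho> ^ n * (1 + real s) powr \<gamma> / 4 ^ s"
      unfolding eL[symmetric] by (simp add: power_divide)
    finally show ?thesis using False by simp
  qed
  define D where "D = 2 ^ n0 + 2 / (1 - \<rho>)"
  show ?thesis
  proof (intro exI[of _ D] conjI allI)
    show "0 \<le> D" using \<rho> by (simp add: D_def)
    fix N s
    have "(\<Sum>n<N. 2 ^ n * min (l n) (1 / 4 ^ s)) \<le>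
        (\<Sum>n<N. ((if n < n0 then 2 ^ n else 0) + 2 * \<rho> ^ n) * ((1 + real s) powr \<gamma> / 4 ^ s))"
      using summand by (intro sum_mono) simp
    also have "\<dots> = ((\<Sum>n<N. if n < n0 then 2 ^ n else 0) + 2 * (\<Sum>n<N. \<rho> ^ n)) * ((1 + real s) powr \<gamma> / 4 ^ s)"
      by (simp only: sum_distrib_right[symmetric] sum.distrib sum_distrib_left)
    also have "\<dots> \<le> D * ((1 + real s) powr \<gamma> / 4 ^ s)"
    proof (rule mult_right_mono)
      have "(\<Sum>n<N. if n < n0 then 2 ^ n else 0) = (\<Sum>n\<in>{..<N} \<inter> {..<n0}. 2 ^ n :: real)"
        by (subst sum.inter_restrict) auto
      also have "\<dots> \<le> (\<Sum>n<n0. 2 ^ n)" by (intro sum_mono2) auto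
      also have "\<dots> \<le> 2 ^ n0" by (simp add: sum_gp_strict)
      finally have "(\<Sum>n<N. if n < n0 then 2 ^ n else 0) \<le> (2 ^ n0 :: real)" .
      moreover have "(\<Sum>n<N. \<rho> ^ n) \<le> (\<Sum>n. \<rho> ^ n)"
        using \<rho> by (intro sum_le_suminf summable_geometric) auto
      then have "(\<Sum>n<N. \<rho> ^ n) \<le> 1 / (1 - \<rho>)" using \<rho> by (simp add: suminf_geometric)
      ultimately show "(\<Sum>n<N. if n < n0 then 2 ^ n else 0) + 2 * (\<Sum>n<N. \<rho> ^ n) \<le> D"
        by (simp add: D_def)
    qed simp
    finally show "(\<Sum>n<N. 2 ^ n * min (l n) (1 / 4 ^ s)) \<le> D * (1 + real s) powr ((1 + \<delta>) / 4) / 4 ^ s"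
      by (simp add: \<gamma>_def)
  qed
qed

text \<open>On the scale \<open>4 ^ s\<close> the factor \<open>1 + s\<close> stands for
  \<open>1 + log \<bar>\<xi>\<bar>\<close>. Squaring doubles the exponent
  \<open>(1 + \<delta>) / 4\<close>, and \<open>(1 + \<delta>) / 2\<close> is still below 1. The
  term of [0,1] is absorbed into \<open>1 + D\<close>.\<close>

lemma (in cantor_ratios) norm_fourier_cantor_decay:
  assumes delta: "0 < \<delta>" "\<delta> < 1"
    and sum: "summable (\<lambda>n. gap_length \<alpha> (Suc n) powr (1 / 4 powr (real (Suc n) / \<delta>)))"
  shows "\<exists>D\<ge>0. \<forall>A \<in> {cantor_set \<alpha>, cantor_complement \<alpha>}. \<forall>s \<xi>. 4 ^ s \<le> \<bar>\<xi>\<bar> \<longrightarrow>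
    (norm (fourier_transform (indicator A) \<xi>))\<^sup>2 \<le> D * (1 + real s) powr ((1 + \<delta>) / 2) / 16 ^ s"
proof -
  from truncated_gap_sum_le[OF delta gap_length_pos sum] obtain D where D: "0 \<le> D"
    "\<And>N s. (\<Sum>n<N. 2 ^ n * min (gap_length \<alpha> (Suc n)) (1 / 4 ^ s)) \<le> D * (1 + real s) powr ((1 + \<delta>) / 4) / 4 ^ s"
    by blast
  show ?thesis
  proof (intro exI[of _ "(1 + D)\<^sup>2"] conjI ballI allI impI)
    fix A s and \<xi> :: real
    assume A: "A \<in> {cantor_set \<alpha>, cantor_complement \<alpha>}" and \<xi>: "4 ^ s \<le> \<bar>\<xi>\<bar>"
    define S where "S = D * (1 + real s) powr ((1 + \<delta>) / 4) / 4 ^ s"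
    have "(0::real) < 4 ^ s" by simp
    with \<xi> have "0 < \<bar>\<xi>\<bar>" by linarith
    then have xi0: "\<xi> \<noteq> 0" by simp
    have "(4::real) ^ s \<le> pi * \<bar>\<xi>\<bar>"
      using mult_mono[of 1 pi "4 ^ s" "\<bar>\<xi>\<bar>"] \<xi> pi_gt3 by simp
    then have inv: "1 / (pi * \<bar>\<xi>\<bar>) \<le> 1 / 4 ^ s"
      using xi0 by (intro divide_left_mono) auto
    have "(\<Sum>n<N. 2 ^ n * min (gap_length \<alpha> (Suc n)) (1 / (pi * \<bar>\<xi>\<bar>))) \<le> S" for N
    proof -
      have "(\<Sum>n<N. 2 ^ n * min (gap_length \<alpha> (Suc n)) (1 / (pi * \<bar>\<xi>\<bar>))) \<le>
          (\<Sum>n<N. 2 ^ n * min (gap_length \<alpha> (Suc n)) (1 / 4 ^ s))"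
        using inv by (intro sum_mono mult_left_mono min.mono) auto
      then show ?thesis using D(2)[of s N] by (simp add: S_def)
    qed
    from norm_fourier_cantor_le[OF xi0 this] A
    have "norm (fourier_transform (indicator A) \<xi>) \<le> 1 / (pi * \<bar>\<xi>\<bar>) + S" by auto
    also have "\<dots> \<le> (1 + D) * (1 + real s) powr ((1 + \<delta>) / 4) / 4 ^ s"
    proof -
      have "1 \<le> (1 + real s) powr ((1 + \<delta>) / 4)" using delta by (intro ge_one_powr_ge_zero) auto
      then have "1 / 4 ^ s \<le> (1 + real s) powr ((1 + \<delta>) / 4) / 4 ^ s" by (intro divide_right_mono) auto
      then show ?thesis using inv by (simp add: S_def distrib_right add_divide_distrib)
    qed
    finally have "(norm (fourier_transform (indicator A) \<xi>))\<^sup>2 \<le>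
        ((1 + D) * (1 + real s) powr ((1 + \<delta>) / 4) / 4 ^ s)\<^sup>2" by (intro power_mono) auto
    also have "\<dots> = (1 + D)\<^sup>2 * (1 + real s) powr ((1 + \<delta>) / 2) / 16 ^ s"
    proof -
      have "((1 + real s) powr ((1 + \<delta>) / 4))\<^sup>2 = (1 + real s) powr ((1 + \<delta>) / 2)"
        by (simp add: power2_eq_square flip: powr_add)
      moreover have "((4::real) ^ s)\<^sup>2 = 16 ^ s" by (simp add: power2_eq_square flip: power_mult_distrib)
      ultimately show ?thesis by (simp add: power_mult_distrib power_divide)
    qed
    finally show "(norm (fourier_transform (indicator A) \<xi>))\<^sup>2 \<le>
        (1 + D)\<^sup>2 * (1 + real s) powr ((1 + \<delta>) / 2) / 16 ^ s" .
  qed simp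
qed

section \<open>Moments of linear statistics\<close>

text \<open>Points are counted without multiplicity, in agreement with
  \<open>distinct_tuple_sum\<close>; on simple configurations this is the integral of f against
  \<open>config_measure\<close>. Restricting to nonzero values makes the index set finite for test
  functions.\<close>

definition linear_statistic :: "(real \<Rightarrow> real) \<Rightarrow> config \<Rightarrow> real" where
  "linear_statistic f X = (\<Sum>x\<in>{x\<in>config_points X. f x \<noteq> 0}. f x)"

definition test_function :: "(real \<Rightarrow> real) \<Rightarrow> bool" where
  "test_function f \<longleftrightarrow> f \<in> borel_measurable borel \<and> bounded (range f) \<and>
     (\<exists>R. \<forall>x. f x \<noteq> 0 \<longrightarrow> \<bar>x\<bar> \<le> R)"

lemma finite_config_points:
  assumes "test_function f"
  shows "finite {x\<in>config_points X. f x \<noteq> 0}"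
proof -
  obtain R where R: "\<And>x. f x \<noteq> 0 \<Longrightarrow> \<bar>x\<bar> \<le> R"
    using assms unfolding test_function_def by blast
  have "finite {x \<in> {-R..R}. multiplicity X x \<noteq> 0}"
    using multiplicity[of X] compact_Icc[of "-R" R] by blast
  then show ?thesis
    by (rule rev_finite_subset) (use R in \<open>fastforce simp: config_points_def\<close>)
qed

lemma distinct_tuple_sum_1:
  assumes "test_function f"
  shows "distinct_tuple_sum 1 (\<lambda>x. complex_of_real (f (x 0))) X = of_real (linear_statistic f X)"
proof -
  define F where "F = {x\<in>config_points X. f x \<noteq> 0}"
  define S where "S = {x \<in> {..<1::nat} \<rightarrow>\<^sub>E F. inj_on x {..<1}}"
  have F: "finite F" unfolding F_def using assms by (rule finite_config_points)
  have S: "finite S" unfolding S_def using F by (intro finite_Collect_conjI disjI1) (simp add: finite_PiE)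
  have "distinct_tuple_sum 1 (\<lambda>x. complex_of_real (f (x 0))) X =
      (\<Sum>\<^sub>\<infinity>x\<in>S. complex_of_real (f (x 0)))"
    unfolding distinct_tuple_sum_def S_def F_def
    by (rule infsum_cong_neutral) (auto simp: PiE_iff)
  also have "\<dots> = (\<Sum>x\<in>S. complex_of_real (f (x 0)))" using S by simp
  also have "\<dots> = (\<Sum>x\<in>F. complex_of_real (f x))"
    by (rule sum.reindex_bij_witness[of _ "\<lambda>y. \<lambda>i\<in>{..<1}. y" "\<lambda>x. x 0"])
      (auto simp: S_def PiE_iff extensional_def fun_eq_iff inj_on_def)
  finally show ?thesis by (simp add: linear_statistic_def F_def)
qed

text \<open>Pairs of distinct points are all pairs minus the diagonal.\<close>

lemma distinct_tuple_sum_2: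
  assumes "test_function f"
  shows "distinct_tuple_sum 2 (\<lambda>x. complex_of_real (f (x 0) * f (x 1))) X =
    of_real ((linear_statistic f X)\<^sup>2 - linear_statistic (\<lambda>x. (f x)\<^sup>2) X)"
proof -
  define F where "F = {x\<in>config_points X. f x \<noteq> 0}"
  define S where "S = {x \<in> {..<2::nat} \<rightarrow>\<^sub>E F. inj_on x {..<2}}"
  have F: "finite F" unfolding F_def using assms by (rule finite_config_points)
  have S: "finite S" unfolding S_def using F by (intro finite_Collect_conjI disjI1) (simp add: finite_PiE)
  have two: "{..<2::nat} = {0, 1}" by auto
  have "distinct_tuple_sum 2 (\<lambda>x. complex_of_real (f (x 0) * f (x 1))) X =
      (\<Sum>\<^sub>\<infinity>x\<in>S. complex_of_real (f (x 0) * f (x 1)))"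
    unfolding distinct_tuple_sum_def S_def F_def
    by (rule infsum_cong_neutral) (auto simp: PiE_iff two)
  also have "\<dots> = (\<Sum>x\<in>S. complex_of_real (f (x 0) * f (x 1)))" using S by simp
  also have "\<dots> = (\<Sum>p\<in>F \<times> F - (\<lambda>x. (x, x)) ` F. complex_of_real (f (fst p) * f (snd p)))"
    by (rule sum.reindex_bij_witness
          [of _ "\<lambda>p. \<lambda>i\<in>{..<2}. if i = 0 then fst p else snd p" "\<lambda>x. (x 0, x 1)"])
      (auto simp: S_def PiE_iff extensional_def fun_eq_iff two inj_on_def)
  also have "\<dots> = of_real ((\<Sum>p\<in>F \<times> F. f (fst p) * f (snd p)) -
      (\<Sum>p\<in>(\<lambda>x. (x, x)) ` F. f (fst p) * f (snd p)))"
    using F by (subst sum_diff) auto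
  also have "(\<Sum>p\<in>F \<times> F. f (fst p) * f (snd p)) = (\<Sum>x\<in>F. f x)\<^sup>2"
    by (simp add: power2_eq_square sum_product sum.cartesian_product case_prod_beta)
  also have "(\<Sum>p\<in>(\<lambda>x. (x, x)) ` F. f (fst p) * f (snd p)) = (\<Sum>x\<in>F. (f x)\<^sup>2)"
    by (subst sum.reindex) (auto simp: inj_on_def power2_eq_square)
  finally show ?thesis by (simp add: linear_statistic_def F_def)
qed

lemma test_function_tests:
  assumes "test_function f"
  shows "bounded_compactly_supported_measurable 1 (\<lambda>x. complex_of_real (f (x 0)))"
    and "bounded_compactly_supported_measurable 2 (\<lambda>x. complex_of_real (f (x 0) * f (x 1)))"
proof -
  have [measurable]: "f \<in> borel_measurable borel" using assms by (simp add: test_function_def)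
  obtain R where R: "\<And>x. f x \<noteq> 0 \<Longrightarrow> \<bar>x\<bar> \<le> R"
    using assms unfolding test_function_def by blast
  obtain b where b: "\<And>x. \<bar>f x\<bar> \<le> b"
    using assms unfolding test_function_def bounded_iff by auto
  have b0: "0 \<le> b" using b[of 0] by linarith
  have two: "{..<2::nat} = {0, 1}" by auto
  have R': "x \<in> {-R..R}" if "f x \<noteq> 0" for x using R[OF that] by auto
  show "bounded_compactly_supported_measurable 1 (\<lambda>x. complex_of_real (f (x 0)))"
    unfolding bounded_compactly_supported_measurable_def
    by (intro conjI exI[of _ "{-R..R}"])
      (use b R' in \<open>auto simp: bounded_iff PiE_iff abs_le_iff\<close>)
  have "\<bar>f x * f y\<bar> \<le> b * b" for x y unfolding abs_mult using b b0 by (intro mult_mono) auto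
  then have "bounded ((\<lambda>x. complex_of_real (f (x 0) * f (x 1))) ` ({..<2::nat} \<rightarrow>\<^sub>E UNIV))"
    unfolding bounded_iff by (intro exI[of _ "b * b"]) (auto simp: norm_mult abs_mult)
  then show "bounded_compactly_supported_measurable 2 (\<lambda>x. complex_of_real (f (x 0) * f (x 1)))"
    unfolding bounded_compactly_supported_measurable_def
    by (intro conjI exI[of _ "{-R..R}"]) (use R' in \<open>auto simp: two PiE_iff\<close>)
qed

lemma det_mat_1: "Determinant.det (Matrix.mat 1 1 (\<lambda>(i, j). K i j)) = K 0 0"
  by (subst det_single) auto

lemma det_mat_2:
  "Determinant.det (Matrix.mat 2 2 (\<lambda>(i, j). K i j)) = K 0 0 * K 1 1 - K 0 1 * (K 1 0 :: 'a :: comm_ring_1)"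
  by (subst laplace_expansion_row[of _ 2 0])
    (auto simp: numeral_2_eq_2 cofactor_def mat_delete_def det_single)

lemma test_function_integrable:
  assumes "test_function f"
  shows "integrable lborel f"
proof -
  have [measurable]: "f \<in> borel_measurable borel" using assms by (simp add: test_function_def)
  obtain R where R: "\<And>x. f x \<noteq> 0 \<Longrightarrow> \<bar>x\<bar> \<le> R"
    using assms unfolding test_function_def by blast
  obtain b where b: "\<And>x. \<bar>f x\<bar> \<le> b"
    using assms unfolding test_function_def bounded_iff by auto
  have "integrable lborel (\<lambda>x. b * indicator {-R..R} x)"
    by (intro integrable_mult_right integrable_real_indicator) (auto simp: emeasure_lborel_Icc_eq)
  then show ?thesis
  proof (rule Bochner_Integration.integrable_bound)
    show "AE x in lborel. norm (f x) \<le> norm (b * indicator {-R..R} x)"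
    proof (rule AE_I2)
      show "norm (f x) \<le> norm (b * indicator {-R..R} x)" for x
        using b[of x] R[of x] by (cases "f x = 0") (auto simp: indicator_def abs_le_iff)
    qed
  qed simp
qed

lemma test_function_power2:
  assumes "test_function f"
  shows "test_function (\<lambda>x. (f x)\<^sup>2)"
proof -
  obtain b where b: "\<And>x. \<bar>f x\<bar> \<le> b"
    using assms unfolding test_function_def bounded_iff by auto
  then have "(f x)\<^sup>2 \<le> b\<^sup>2" for x by (simp add: abs_le_square_iff[symmetric] order_trans[OF b abs_ge_self])
  then have "bounded (range (\<lambda>x. (f x)\<^sup>2))" unfolding bounded_iff by auto
  then show ?thesis using assms by (auto simp: test_function_def)
qed

text \<open>The one-point density is c and the two-point density
  \<open>c\<^sup>2 - k (x - y)\<close>, a determinant of size 2. The latter governs pairs of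
  distinct points; the diagonal of the squared statistic adds the mean of the statistic of
  \<open>f\<^sup>2\<close>.\<close>

lemma linear_statistic_moments:
  assumes P: "determinantal_process P K" and f: "test_function f"
    and c: "\<And>x. K x x = of_real c" and k: "\<And>x y. K x y * K y x = of_real (k (x - y))"
    and int_k: "integrable lborel k"
  shows "integrable P (linear_statistic f)"
    and "integral\<^sup>L P (linear_statistic f) = c * integral\<^sup>L lborel f"
    and "integrable P (\<lambda>X. (linear_statistic f X)\<^sup>2)"
    and "(\<integral>X. (linear_statistic f X)\<^sup>2 \<partial>P) = (c * integral\<^sup>L lborel f)\<^sup>2 +
      (c * (\<integral>x. (f x)\<^sup>2 \<partial>lborel) - (\<integral>x. f x * (\<integral>y. f y * k (x - y) \<partial>lborel) \<partial>lborel))"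
proof -
  interpret product_sigma_finite "\<lambda>_::nat. lborel :: real measure" by standard
  \<comment> \<open>Stated for every test function, since it is applied to f and to its
    square.\<close>
  have first: "integrable P (linear_statistic g)"
      "integral\<^sup>L P (linear_statistic g) = c * integral\<^sup>L lborel g" if g: "test_function g" for g
  proof -
    have [measurable]: "g \<in> borel_measurable borel" using g by (simp add: test_function_def)
    let ?\<phi> = "\<lambda>x :: nat \<Rightarrow> real. complex_of_real (g (x 0))"
    have "integrable P (distinct_tuple_sum 1 ?\<phi>) \<and>
        integral\<^sup>L P (distinct_tuple_sum 1 ?\<phi>) =
        (\<integral>x. ?\<phi> x * Determinant.det (Matrix.mat 1 1 (\<lambda>(i, j). K (x i) (x j))) \<partial>(\<Pi>\<^sub>M i\<in>{..<1}. lborel))"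
      using P test_function_tests(1)[OF g]
      unfolding determinantal_process_def Let_def by auto
    moreover have "distinct_tuple_sum 1 ?\<phi> = (\<lambda>X. complex_of_real (linear_statistic g X))"
      using distinct_tuple_sum_1[OF g] by (intro ext)
    moreover have "{..<1::nat} = {0}" by auto
    ultimately have I: "integrable P (\<lambda>X. complex_of_real (linear_statistic g X))" and
      E: "(\<integral>X. complex_of_real (linear_statistic g X) \<partial>P) =
          (\<integral>x. complex_of_real (g (x 0)) * of_real c \<partial>(\<Pi>\<^sub>M i\<in>{0::nat}. lborel))"
      by (simp_all only: det_mat_1 c)
    from I have "integrable P (\<lambda>X. Re (complex_of_real (linear_statistic g X)))" by (rule integrable_Re)
    then show "integrable P (linear_statistic g)" by simp
    have "(\<integral>x. complex_of_real (g (x 0)) * of_real c \<partial>(\<Pi>\<^sub>M i\<in>{0::nat}. lborel)) =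
        (\<integral>x. complex_of_real (g x) * of_real c \<partial>lborel)"
      by (rule product_integral_singleton[of "\<lambda>x. complex_of_real (g x) * of_real c" 0]) simp
    also have "\<dots> = complex_of_real (c * integral\<^sup>L lborel g)" by simp
    finally show "integral\<^sup>L P (linear_statistic g) = c * integral\<^sup>L lborel g"
      using E by (simp only: integral_complex_of_real of_real_eq_iff)
  qed
  show "integrable P (linear_statistic f)"
    "integral\<^sup>L P (linear_statistic f) = c * integral\<^sup>L lborel f"
    using first[OF f] by auto
  have [measurable]: "f \<in> borel_measurable borel" using f by (simp add: test_function_def)
  have [measurable]: "k \<in> borel_measurable borel" using borel_measurable_integrable[OF int_k] by simp
  obtain b where b: "\<And>x. \<bar>f x\<bar> \<le> b"
    using f unfolding test_function_def bounded_iff by auto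
  let ?\<phi> = "\<lambda>x :: nat \<Rightarrow> real. complex_of_real (f (x 0) * f (x 1))"
  let ?h = "\<lambda>x y. f x * f y * (c\<^sup>2 - k (x - y))"
  let ?I = "integral\<^sup>L lborel f"
  define Q where "Q = (\<lambda>x. \<integral>y. f y * k (x - y) \<partial>lborel)"
  have shift: "integrable lborel (\<lambda>y. k (x - y))" for x
    using lborel_integrable_real_affine[OF int_k, of "-1" x] by simp
  have fk: "integrable lborel (\<lambda>y. f y * k (x - y))" for x
    by (rule Bochner_Integration.integrable_bound[OF integrable_mult_right[OF integrable_abs[OF shift[of x]], of b]])
      (auto simp: abs_mult intro!: mult_right_mono b order_trans[OF b abs_ge_self])
  have Q_bound: "\<bar>Q x\<bar> \<le> b * (\<integral>y. \<bar>k y\<bar> \<partial>lborel)" for x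
  proof -
    have "\<bar>Q x\<bar> \<le> (\<integral>y. \<bar>f y * k (x - y)\<bar> \<partial>lborel)"
      unfolding Q_def by (rule integral_abs_bound)
    also have "\<dots> \<le> (\<integral>y. b * \<bar>k (x - y)\<bar> \<partial>lborel)"
      using fk shift by (intro integral_mono integrable_abs integrable_mult_right)
        (auto simp: abs_mult intro!: mult_right_mono b)
    also have "\<dots> = b * (\<integral>y. \<bar>k y\<bar> \<partial>lborel)"
      using lborel_integral_real_affine[of "-1" "\<lambda>y. \<bar>k y\<bar>" x] by simp
    finally show ?thesis .
  qed
  have [measurable]: "Q \<in> borel_measurable borel" unfolding Q_def by measurable
  have fQ: "integrable lborel (\<lambda>x. f x * Q x)"
  proof (rule Bochner_Integration.integrable_bound)
    show "integrable lborel (\<lambda>x. \<bar>f x\<bar> * (b * (\<integral>y. \<bar>k y\<bar> \<partial>lborel)))"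
      using test_function_integrable[OF f] by (intro integrable_mult_left integrable_abs)
    show "AE x in lborel. norm (f x * Q x) \<le> norm (\<bar>f x\<bar> * (b * (\<integral>y. \<bar>k y\<bar> \<partial>lborel)))"
      unfolding real_norm_def abs_mult[of "f _"] abs_mult[of "\<bar>f _\<bar>"] abs_idempotent
      by (intro AE_I2 mult_left_mono order_trans[OF Q_bound abs_ge_self]) simp
  qed simp
  have inner: "(\<integral>y. ?h x y \<partial>lborel) = c\<^sup>2 * ?I * f x - f x * Q x" for x
  proof -
    have "?h x y = f x * c\<^sup>2 * f y - f x * (f y * k (x - y))" for y by (simp add: algebra_simps)
    then have "(\<integral>y. ?h x y \<partial>lborel) = (\<integral>y. f x * c\<^sup>2 * f y - f x * (f y * k (x - y)) \<partial>lborel)" by simp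
    also have "\<dots> = f x * c\<^sup>2 * ?I - f x * Q x"
      unfolding Q_def using test_function_integrable[OF f] fk by (subst Bochner_Integration.integral_diff) auto
    finally show ?thesis by simp
  qed
  have "integrable P (distinct_tuple_sum 2 ?\<phi>) \<and>
      integrable (\<Pi>\<^sub>M i\<in>{..<2}. lborel) (\<lambda>x. ?\<phi> x * Determinant.det (Matrix.mat 2 2 (\<lambda>(i, j). K (x i) (x j)))) \<and>
      integral\<^sup>L P (distinct_tuple_sum 2 ?\<phi>) =
      (\<integral>x. ?\<phi> x * Determinant.det (Matrix.mat 2 2 (\<lambda>(i, j). K (x i) (x j))) \<partial>(\<Pi>\<^sub>M i\<in>{..<2}. lborel))"
    using P test_function_tests(2)[OF f]
    unfolding determinantal_process_def Let_def by auto
  moreover have "distinct_tuple_sum 2 ?\<phi> = (\<lambda>X. complex_of_real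
      ((linear_statistic f X)\<^sup>2 - linear_statistic (\<lambda>x. (f x)\<^sup>2) X))"
    using distinct_tuple_sum_2[OF f] by (intro ext)
  moreover have "{..<2::nat} = insert 1 {0}" by auto
  moreover have "?\<phi> x * Determinant.det (Matrix.mat 2 2 (\<lambda>(i, j). K (x i) (x j))) =
      complex_of_real (?h (x 0) (x 1))" for x
    by (simp only: det_mat_2 c k) (simp add: power2_eq_square)
  ultimately have I: "integrable P (\<lambda>X. complex_of_real ((linear_statistic f X)\<^sup>2 - linear_statistic (\<lambda>x. (f x)\<^sup>2) X))"
    and J: "integrable (\<Pi>\<^sub>M i\<in>insert (1::nat) {0}. lborel) (\<lambda>x. complex_of_real (?h (x 0) (x 1)))"
    and E: "(\<integral>X. complex_of_real ((linear_statistic f X)\<^sup>2 - linear_statistic (\<lambda>x. (f x)\<^sup>2) X) \<partial>P) =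
      (\<integral>x. complex_of_real (?h (x 0) (x 1)) \<partial>(\<Pi>\<^sub>M i\<in>insert (1::nat) {0}. lborel))"
    by (simp_all only:)
  from J have J: "integrable (\<Pi>\<^sub>M i\<in>insert (1::nat) {0}. lborel) (\<lambda>x. ?h (x 0) (x 1))"
    by (drule_tac integrable_Re) simp
  have "(\<integral>x. ?h (x 0) (x 1) \<partial>(\<Pi>\<^sub>M i\<in>insert (1::nat) {0}. lborel)) =
      (\<integral>x. (\<integral>y. ?h (x 0) y \<partial>lborel) \<partial>(\<Pi>\<^sub>M i\<in>{0::nat}. lborel))"
    by (subst product_integral_insert[OF _ _ J]) auto
  also have "\<dots> = (\<integral>x. c\<^sup>2 * ?I * f x - f x * Q x \<partial>lborel)"
    unfolding inner by (rule product_integral_singleton[of "\<lambda>x. c\<^sup>2 * ?I * f x - f x * Q x" 0]) simp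
  also have "\<dots> = c\<^sup>2 * ?I * ?I - (\<integral>x. f x * Q x \<partial>lborel)"
    unfolding Bochner_Integration.integral_diff[OF integrable_mult_right[OF test_function_integrable[OF f]] fQ]
    by (simp only: integral_mult_right_zero)
  finally have "(\<integral>x. ?h (x 0) (x 1) \<partial>(\<Pi>\<^sub>M i\<in>insert (1::nat) {0}. lborel)) =
      (c * ?I)\<^sup>2 - (\<integral>x. f x * Q x \<partial>lborel)"
    by (simp add: power2_eq_square)
  with E have E2: "(\<integral>X. (linear_statistic f X)\<^sup>2 - linear_statistic (\<lambda>x. (f x)\<^sup>2) X \<partial>P) =
      (c * ?I)\<^sup>2 - (\<integral>x. f x * Q x \<partial>lborel)"
    by (simp only: integral_complex_of_real of_real_eq_iff)
  from I have "integrable P (\<lambda>X. Re (complex_of_real ((linear_statistic f X)\<^sup>2 - linear_statistic (\<lambda>x. (f x)\<^sup>2) X)))"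
    by (rule integrable_Re)
  then have I: "integrable P (\<lambda>X. (linear_statistic f X)\<^sup>2 - linear_statistic (\<lambda>x. (f x)\<^sup>2) X)"
    by (simp only: Re_complex_of_real)
  note sq = first[OF test_function_power2[OF f]]
  from Bochner_Integration.integrable_add[OF I sq(1)] show "integrable P (\<lambda>X. (linear_statistic f X)\<^sup>2)" by simp
  from Bochner_Integration.integral_add[OF I sq(1)] E2 sq(2)
  show "(\<integral>X. (linear_statistic f X)\<^sup>2 \<partial>P) = (c * ?I)\<^sup>2 +
      (c * (\<integral>x. (f x)\<^sup>2 \<partial>lborel) - (\<integral>x. f x * (\<integral>y. f y * k (x - y) \<partial>lborel) \<partial>lborel))"
    by (simp add: Q_def)
qed

section \<open>The variance as an energy\<close>

text \<open>Expanding the square leaves twice the squared norm of f minus twice its autocorrelation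
  \<open>?r t\<close>. Integrated against the even function k, the autocorrelation becomes the
  double integral of f(x) f(y) k(x - y).\<close>

lemma energy_identity:
  assumes f: "test_function f" and k: "integrable lborel k" and even: "\<And>t. k (- t) = k t"
  shows "(\<integral>t. k t * (\<integral>x. (f (x + t) - f x)\<^sup>2 \<partial>lborel) \<partial>lborel) =
    2 * ((\<integral>t. k t \<partial>lborel) * (\<integral>x. (f x)\<^sup>2 \<partial>lborel) -
      (\<integral>x. f x * (\<integral>y. f y * k (x - y) \<partial>lborel) \<partial>lborel))"
proof -
  have [measurable]: "f \<in> borel_measurable borel" using f by (simp add: test_function_def)
  have [measurable]: "k \<in> borel_measurable borel" using borel_measurable_integrable[OF k] by simp
  obtain b where b: "\<And>x. \<bar>f x\<bar> \<le> b"
    using f unfolding test_function_def bounded_iff by auto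
  note fi = test_function_integrable[OF f]
  note f2 = test_function_integrable[OF test_function_power2[OF f]]
  let ?N = "\<integral>x. (f x)\<^sup>2 \<partial>lborel"
  let ?r = "\<lambda>t. \<integral>x. f x * f (x + t) \<partial>lborel"
  have f2t: "integrable lborel (\<lambda>x. (f (x + t))\<^sup>2)" for t
    using lborel_integrable_real_affine[OF f2, of 1 t] by (simp add: add.commute)
  have fft: "integrable lborel (\<lambda>x. f x * f (x + t))" for t
    by (rule Bochner_Integration.integrable_bound[OF integrable_mult_right[OF integrable_abs[OF fi], of b]])
      (auto simp: abs_mult mult.commute[of b] intro!: mult_left_mono order_trans[OF b abs_ge_self])
  have D: "(\<integral>x. (f (x + t) - f x)\<^sup>2 \<partial>lborel) = 2 * ?N - 2 * ?r t" for t
  proof -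
    have "(\<integral>x. (f (x + t) - f x)\<^sup>2 \<partial>lborel) =
        (\<integral>x. ((f (x + t))\<^sup>2 + (f x)\<^sup>2) - 2 * (f x * f (x + t)) \<partial>lborel)"
      by (simp add: power2_diff algebra_simps)
    also have "\<dots> = ((\<integral>x. (f (x + t))\<^sup>2 \<partial>lborel) + ?N) - 2 * ?r t"
      using f2 f2t[of t] fft[of t] by simp
    also have "(\<integral>x. (f (x + t))\<^sup>2 \<partial>lborel) = ?N"
      using lborel_integral_real_affine[of 1 "\<lambda>x. (f x)\<^sup>2" t] by (simp add: add.commute)
    finally show ?thesis by simp
  qed
  let ?h = "\<lambda>t x. k t * (f x * f (x + t))"
  have pair: "integrable (lborel \<Otimes>\<^sub>M lborel) (case_prod ?h)"
  proof (rule integrable_pair_bound[OF integrable_mult_right[OF integrable_abs[OF k], of b] integrable_abs[OF fi]])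
    show "norm (?h t x) \<le> b * \<bar>k t\<bar> * \<bar>f x\<bar>" for t x
      using mult_left_mono[OF b[of "x + t"], of "\<bar>k t\<bar> * \<bar>f x\<bar>"] by (simp add: abs_mult mult_ac)
  qed measurable
  have kr: "integrable lborel (\<lambda>t. k t * ?r t)"
    using lborel_pair.integrable_fst[OF pair] by simp
  have "(\<integral>t. k t * ?r t \<partial>lborel) = (\<integral>t. (\<integral>x. ?h t x \<partial>lborel) \<partial>lborel)" by simp
  also have "\<dots> = (\<integral>x. (\<integral>t. ?h t x \<partial>lborel) \<partial>lborel)"
    by (rule lborel_pair.Fubini_integral[OF pair, symmetric])
  also have "\<dots> = (\<integral>x. f x * (\<integral>y. f y * k (x - y) \<partial>lborel) \<partial>lborel)"
  proof (rule Bochner_Integration.integral_cong[OF refl])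
    fix x
    have "?h t x = f x * (f (x + t) * k t)" for t by simp
    then have "(\<integral>t. ?h t x \<partial>lborel) = f x * (\<integral>t. f (x + t) * k t \<partial>lborel)"
      by (simp only: integral_mult_right_zero)
    also have "(\<integral>t. f (x + t) * k t \<partial>lborel) = (\<integral>y. f y * k (x - y) \<partial>lborel)"
      using lborel_integral_real_affine[of 1 "\<lambda>y. f y * k (x - y)" x] by (simp add: even)
    finally show "(\<integral>t. ?h t x \<partial>lborel) = f x * (\<integral>y. f y * k (x - y) \<partial>lborel)" .
  qed
  finally have Q: "(\<integral>t. k t * ?r t \<partial>lborel) = \<dots>" .
  have "(\<integral>t. k t * (\<integral>x. (f (x + t) - f x)\<^sup>2 \<partial>lborel) \<partial>lborel) =
      (\<integral>t. (2 * ?N) * k t - 2 * (k t * ?r t) \<partial>lborel)"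
    unfolding D by (simp add: algebra_simps)
  also have "\<dots> = (2 * ?N) * (\<integral>t. k t \<partial>lborel) - 2 * (\<integral>t. k t * ?r t \<partial>lborel)"
    using k kr by simp
  finally show ?thesis unfolding Q by (simp add: algebra_simps)
qed

text \<open>The variance has the shape of half the energy, with c in place of the integral of k. For
  kernels that come from a projection of Fourier type, \<open>c_le\<close> is Plancherel's
  inequality, supplied by \<open>measure_le_fourier_energy\<close>.\<close>

lemma linear_statistic_variance_le:
  assumes P: "determinantal_process P K" and f: "test_function f"
    and c: "\<And>x. K x x = of_real c" and k: "\<And>x y. K x y * K y x = of_real (k (x - y))"
    and int_k: "integrable lborel k" and even: "\<And>t. k (- t) = k t"
    and c_le: "c \<le> integral\<^sup>L lborel k"
  shows "integrable P (\<lambda>X. (linear_statistic f X - integral\<^sup>L P (linear_statistic f))\<^sup>2)"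
    and "(\<integral>X. (linear_statistic f X - integral\<^sup>L P (linear_statistic f))\<^sup>2 \<partial>P) \<le>
      (\<integral>t. k t * (\<integral>x. (f (x + t) - f x)\<^sup>2 \<partial>lborel) \<partial>lborel) / 2"
proof -
  interpret prob_space P
    using P by (simp add: determinantal_process_def simple_point_process_def point_process_def)
  let ?E = "integral\<^sup>L P (linear_statistic f)"
  note m = linear_statistic_moments[OF P f c k int_k]
  have *: "(linear_statistic f X - ?E)\<^sup>2 = (linear_statistic f X)\<^sup>2 + (?E\<^sup>2 - 2 * ?E * linear_statistic f X)" for X
    by (simp add: power2_diff)
  show "integrable P (\<lambda>X. (linear_statistic f X - ?E)\<^sup>2)"
    unfolding * using m(1,3) by simp
  have "(\<integral>X. (linear_statistic f X - ?E)\<^sup>2 \<partial>P) = (\<integral>X. (linear_statistic f X)\<^sup>2 \<partial>P) - ?E\<^sup>2"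
    unfolding * using m(1,3) by (simp add: prob_space power2_eq_square)
  also have "\<dots> = c * (\<integral>x. (f x)\<^sup>2 \<partial>lborel) - (\<integral>x. f x * (\<integral>y. f y * k (x - y) \<partial>lborel) \<partial>lborel)"
    unfolding m(4) m(2) by simp
  also have "\<dots> \<le> (\<integral>t. k t \<partial>lborel) * (\<integral>x. (f x)\<^sup>2 \<partial>lborel) -
      (\<integral>x. f x * (\<integral>y. f y * k (x - y) \<partial>lborel) \<partial>lborel)"
    using c_le by (intro diff_right_mono mult_right_mono) auto
  also have "\<dots> = (\<integral>t. k t * (\<integral>x. (f (x + t) - f x)\<^sup>2 \<partial>lborel) \<partial>lborel) / 2"
    unfolding energy_identity[OF f int_k even] by simp
  finally show "(\<integral>X. (linear_statistic f X - ?E)\<^sup>2 \<partial>P) \<le>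
      (\<integral>t. k t * (\<integral>x. (f (x + t) - f x)\<^sup>2 \<partial>lborel) \<partial>lborel) / 2" .
qed

section \<open>A criterion for number rigidity\<close>

lemma sets_config_measure [simp]: "sets (config_measure X) = UNIV"
  by (simp add: config_measure_def)

lemma measurable_config_measure [simp]: "f \<in> measurable (config_measure X) borel"
  by (rule measurableI) (auto simp: config_measure_def)

lemma space_counting_algebra [simp]: "space (counting_algebra S) = UNIV"
  by (simp add: counting_algebra_def space_measure_of_conv)

lemma config_count_measurable:
  assumes "B \<in> sets borel" "B \<subseteq> S"
  shows "config_count B \<in> borel_measurable (counting_algebra S)"
proof (rule measurableI)
  fix A :: "ennreal set" assume "A \<in> sets borel"
  then have "config_count B -` A \<in> {config_count B -` A | B A. B \<in> sets borel \<and> B \<subseteq> S \<and> A \<in> sets borel}"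
    using assms by blast
  then have "config_count B -` A \<in> sets (counting_algebra S)"
    unfolding counting_algebra_def by (simp add: sets_measure_of_conv sigma_sets.Basic)
  then show "config_count B -` A \<inter> space (counting_algebra S) \<in> sets (counting_algebra S)"
    by simp
qed simp

text \<open>Induction on g from indicators, whose integral is a counting function of
  \<open>A \<inter> S\<close>. With S the complement of B, the outer part of a linear statistic is
  thereby a function of the outside configuration.\<close>

lemma nn_integral_config_measurable:
  fixes g :: "real \<Rightarrow> ennreal"
  assumes "g \<in> borel_measurable borel" and S: "S \<in> sets borel"
  shows "(\<lambda>X. \<integral>\<^sup>+x. g x * indicator S x \<partial>config_measure X) \<in> borel_measurable (counting_algebra S)"
  using assms(1)
proof (induction rule: borel_measurable_induct)
  case (cong f g)
  have "f = g" by (intro ext cong.hyps(3)) simp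
  then show ?case using cong.IH by (simp only:)
next
  case (set A)
  have "(\<integral>\<^sup>+x. indicator A x * indicator S x \<partial>config_measure X) = config_count (A \<inter> S) X" for X
    by (simp add: config_count_def flip: indicator_inter_arith)
  then show ?case using config_count_measurable[of "A \<inter> S" S] S set.hyps by (simp only: sets.Int inf_le2)
next
  case (mult u c)
  have "(\<integral>\<^sup>+x. c * u x * indicator S x \<partial>config_measure X) =
      c * (\<integral>\<^sup>+x. u x * indicator S x \<partial>config_measure X)" for X
    by (subst nn_integral_cmult[symmetric]) (auto simp: mult_ac)
  then show ?case using borel_measurable_times_ennreal[OF borel_measurable_const mult.IH] by (simp only:)
next
  case (add u v)
  have "(\<integral>\<^sup>+x. (v x + u x) * indicator S x \<partial>config_measure X) =
      (\<integral>\<^sup>+x. v x * indicator S x \<partial>config_measure X) + (\<integral>\<^sup>+x. u x * indicator S x \<partial>config_measure X)" for X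
    by (subst nn_integral_add[symmetric]) (auto simp: distrib_right)
  then show ?case using borel_measurable_add[OF add.IH(2) add.IH(1)] by (simp only:)
next
  case (seq U)
  have "(\<integral>\<^sup>+x. (SUP i. U i) x * indicator S x \<partial>config_measure X) =
      (SUP i. \<integral>\<^sup>+x. U i x * indicator S x \<partial>config_measure X)" for X
  proof -
    have "(SUP i. U i) x * indicator S x = (SUP i. U i x * indicator S x)" for x
      by (auto simp: indicator_def image_image)
    moreover have "incseq (\<lambda>i x. U i x * indicator S x)"
      using seq.hyps(3) by (auto simp: incseq_def le_fun_def indicator_def)
    ultimately show ?thesis by (simp add: nn_integral_monotone_convergence_SUP)
  qed
  then show ?case using borel_measurable_SUP[OF countableI_type seq.IH] by (simp only:)
qed

lemma nn_integral_simple_config: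
  assumes f: "test_function f" and nonneg: "\<And>x. 0 \<le> f x" and X: "simple_config X"
  shows "(\<integral>\<^sup>+x. ennreal (f x) \<partial>config_measure X) = ennreal (linear_statistic f X)"
proof -
  have mult: "multiplicity X x = (if x \<in> config_points X then 1 else 0)" for x
  proof -
    have "config_count {x} X = of_nat (multiplicity X x)"
      unfolding config_count_def config_measure_def
      by (subst emeasure_density) (auto simp: nn_integral_count_space_indicator[symmetric] nn_integral_indicator_singleton)
    then have "ennreal (real (multiplicity X x)) \<le> ennreal 1"
      using X[unfolded simple_config_def, rule_format, of x] by (simp add: ennreal_of_nat_eq_real_of_nat)
    then have "multiplicity X x \<le> 1" by simp
    then show ?thesis by (auto simp: config_points_def)
  qed
  have "(\<integral>\<^sup>+x. ennreal (f x) \<partial>config_measure X) =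
      (\<integral>\<^sup>+x. of_nat (multiplicity X x) * ennreal (f x) \<partial>count_space UNIV)"
    unfolding config_measure_def by (subst nn_integral_density) auto
  also have "\<dots> = (\<Sum>x\<in>{x\<in>config_points X. f x \<noteq> 0}. of_nat (multiplicity X x) * ennreal (f x))"
    using finite_config_points[OF f, of X] nonneg
    by (intro nn_integral_count_space') (auto simp: mult)
  also have "\<dots> = (\<Sum>x\<in>{x\<in>config_points X. f x \<noteq> 0}. ennreal (f x))"
    by (intro sum.cong) (auto simp: mult)
  also have "\<dots> = ennreal (linear_statistic f X)"
    unfolding linear_statistic_def using nonneg by (subst sum_ennreal) auto
  finally show ?thesis .
qed

text \<open>Off a null set N the preimages under f and g agree, and inside N every subset belongs to
  the completion.\<close>

lemma measurable_completed_counting_algebra: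
  assumes P: "point_process P" and g: "g \<in> borel_measurable (counting_algebra S)"
    and ae: "AE X in P. f X = g X"
  shows "f \<in> borel_measurable (completed_counting_algebra P S)"
proof (rule measurableI)
  let ?C = "completed_counting_algebra P S"
  let ?G = "sets (counting_algebra S) \<union> null_sets (completion P)"
  have space: "space ?C = UNIV" by (simp add: completed_counting_algebra_def space_measure_of_conv)
  have sets: "sets ?C = sigma_sets UNIV ?G"
    by (simp add: completed_counting_algebra_def sets_measure_of_conv)
  have spP: "space P = UNIV"
    using P sets_eq_imp_space_eq[of P borel] by (simp add: point_process_def)
  from ae obtain N where N: "N \<in> null_sets P" "{X. f X \<noteq> g X} \<subseteq> N"
    by (auto simp: eventually_ae_filter spP)
  have null: "M \<in> null_sets (completion P)" if "M \<subseteq> N" for M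
    using that N(1) by (rule null_sets_completion_subset[OF _ null_sets_completionI])
  fix A :: "'a set" assume A: "A \<in> sets borel"
  have "g -` A \<in> sets ?C"
    using measurable_sets[OF g A] unfolding sets by (auto intro: sigma_sets.Basic)
  moreover have "N \<in> sets ?C" "f -` A \<inter> N \<in> sets ?C"
    unfolding sets using null by (auto intro!: sigma_sets.Basic)
  moreover have "f -` A \<inter> space ?C = (g -` A - N) \<union> (f -` A \<inter> N)"
    using N(2) by (auto simp: space)
  ultimately show "f -` A \<inter> space ?C \<in> sets ?C" by simp
qed (simp add: completed_counting_algebra_def space_measure_of_conv)

text \<open>A test function equal to 1 on B splits its statistic into the number of points in B and
  a part that depends on the outside only. When the variance is small the statistic is nearly its
  mean, so the number of points is nearly the mean minus the outer part; in the limit this becomes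
  an almost sure identity.\<close>

lemma number_rigid_criterion:
  assumes P: "simple_point_process P"
    and ex: "\<And>R e. 0 < e \<Longrightarrow> \<exists>f. test_function f \<and> (\<forall>x. 0 \<le> f x) \<and> (\<forall>x. \<bar>x\<bar> \<le> R \<longrightarrow> f x = 1) \<and>
      integrable P (\<lambda>X. (linear_statistic f X - integral\<^sup>L P (linear_statistic f))\<^sup>2) \<and>
      (\<integral>X. (linear_statistic f X - integral\<^sup>L P (linear_statistic f))\<^sup>2 \<partial>P) \<le> e"
  shows "number_rigid P"
  unfolding number_rigid_def
proof (intro allI impI)
  fix B :: "real set" assume "compact B"
  then obtain R where R: "\<And>x. x \<in> B \<Longrightarrow> \<bar>x\<bar> \<le> R" by (meson bounded_real compact_imp_bounded)
  have B [measurable]: "B \<in> sets borel" using \<open>compact B\<close> by (rule borel_compact)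
  have "\<forall>n. \<exists>f. test_function f \<and> (\<forall>x. 0 \<le> f x) \<and> (\<forall>x. \<bar>x\<bar> \<le> R \<longrightarrow> f x = 1) \<and>
      integrable P (\<lambda>X. (linear_statistic f X - integral\<^sup>L P (linear_statistic f))\<^sup>2) \<and>
      (\<integral>X. (linear_statistic f X - integral\<^sup>L P (linear_statistic f))\<^sup>2 \<partial>P) \<le> 1 / real (Suc n)"
    by (intro allI ex) simp
  then obtain f where f: "\<And>n. test_function (f n)" "\<And>n x. 0 \<le> f n x" "\<And>n x. \<bar>x\<bar> \<le> R \<Longrightarrow> f n x = 1"
    and int: "\<And>n. integrable P (\<lambda>X. (linear_statistic (f n) X - integral\<^sup>L P (linear_statistic (f n)))\<^sup>2)"
    and var: "\<And>n. (\<integral>X. (linear_statistic (f n) X - integral\<^sup>L P (linear_statistic (f n)))\<^sup>2 \<partial>P) \<le> 1 / real (Suc n)"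
    by metis
  define m where "m n = integral\<^sup>L P (linear_statistic (f n))" for n
  have "(\<lambda>n. \<integral>X. norm ((linear_statistic (f n) X - m n)\<^sup>2) \<partial>P) \<longlonglongrightarrow> 0"
  proof (rule tendsto_sandwich[OF _ _ tendsto_const LIMSEQ_inverse_real_of_nat])
    show "\<forall>\<^sub>F n in sequentially. (\<integral>X. norm ((linear_statistic (f n) X - m n)\<^sup>2) \<partial>P) \<le> inverse (real (Suc n))"
      using var by (simp add: m_def inverse_eq_divide)
  qed simp
  \<comment> \<open>Convergence of the variances to 0 is convergence in mean of the squares; almost
    sure convergence is extracted along a subsequence r.\<close>
  from tendsto_L1_AE_subseq[OF int[folded m_def] this] obtain r where
    r: "AE X in P. (\<lambda>n. (linear_statistic (f (r n)) X - m (r n))\<^sup>2) \<longlonglongrightarrow> 0" by blast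
  have f_meas [measurable]: "f n \<in> borel_measurable borel" for n
    using f(1)[of n] unfolding test_function_def by blast
  define T where "T = (\<lambda>n X. enn2real (\<integral>\<^sup>+x. ennreal (f n x) * indicator (- B) x \<partial>config_measure X))"
  have T [measurable]: "T n \<in> borel_measurable (counting_algebra (- B))" for n
    unfolding T_def
    by (intro borel_measurable_enn2real nn_integral_config_measurable measurable_compose[OF f_meas measurable_ennreal])
      (simp add: B)
  \<comment> \<open>\<open>lim\<close> has an unspecified value where the sequence diverges. The
    function is measurable all the same, and convergence holds almost surely.\<close>
  define g where "g = (\<lambda>X. ennreal (lim (\<lambda>n. m (r n) - T (r n) X)))"
  have "g \<in> borel_measurable (counting_algebra (- B))"
    unfolding g_def
    by (intro measurable_compose[OF _ measurable_ennreal] borel_measurable_lim_metric borel_measurable_diff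
        borel_measurable_const T)
  moreover have "AE X in P. config_count B X = g X"
    using r P[unfolded simple_point_process_def, THEN conjunct2]
  proof eventually_elim
    case (elim X)
    have split: "ennreal (linear_statistic (f n) X) =
        config_count B X + (\<integral>\<^sup>+x. ennreal (f n x) * indicator (- B) x \<partial>config_measure X)" for n
    proof -
      have "ennreal (linear_statistic (f n) X) =
          (\<integral>\<^sup>+x. indicator B x + ennreal (f n x) * indicator (- B) x \<partial>config_measure X)"
        unfolding nn_integral_simple_config[OF f(1,2) elim(2), symmetric]
        by (intro nn_integral_cong) (auto simp: indicator_def f(3) R)
      also have "\<dots> = config_count B X + (\<integral>\<^sup>+x. ennreal (f n x) * indicator (- B) x \<partial>config_measure X)"
        by (subst nn_integral_add) (auto simp: config_count_def)
      finally show ?thesis .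
    qed
    \<comment> \<open>The statistic is a finite real number, so both nonnegative parts of it are
      finite and may be subtracted.\<close>
    have fin: "config_count B X \<noteq> \<top>" using split[of 0] by (metis ennreal_add_eq_top ennreal_neq_top)
    have count: "enn2real (config_count B X) = linear_statistic (f n) X - T n X" for n
    proof -
      have nonneg: "0 \<le> linear_statistic (f n) X" unfolding linear_statistic_def using f(2) by (intro sum_nonneg) auto
      have "(\<integral>\<^sup>+x. ennreal (f n x) * indicator (- B) x \<partial>config_measure X) \<noteq> \<top>"
        using split[of n] by (metis ennreal_add_eq_top ennreal_neq_top)
      then have "enn2real (ennreal (linear_statistic (f n) X)) = enn2real (config_count B X) + T n X"
        unfolding split T_def using fin by (subst enn2real_plus) (auto simp: less_top)
      then show ?thesis using nonneg by simp
    qed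
    have "(\<lambda>n. \<bar>linear_statistic (f (r n)) X - m (r n)\<bar>) \<longlonglongrightarrow> 0"
      using tendsto_real_sqrt[OF elim(1)] by simp
    then have "(\<lambda>n. linear_statistic (f (r n)) X - m (r n)) \<longlonglongrightarrow> 0"
      by (simp add: tendsto_rabs_zero_iff)
    then have "(\<lambda>n. enn2real (config_count B X) - (linear_statistic (f (r n)) X - m (r n))) \<longlonglongrightarrow>
        enn2real (config_count B X) - 0" by (intro tendsto_intros)
    moreover have "enn2real (config_count B X) - (linear_statistic (f (r n)) X - m (r n)) = m (r n) - T (r n) X" for n
      using count[of "r n"] by simp
    ultimately have "lim (\<lambda>n. m (r n) - T (r n) X) = enn2real (config_count B X)"
      by (simp add: limI)
    then show ?case using fin by (simp add: g_def less_top)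
  qed
  ultimately show "config_count B \<in> borel_measurable (completed_counting_algebra P (- B))"
    using P by (intro measurable_completed_counting_algebra) (auto simp: simple_point_process_def)
qed

section \<open>Cutoff functions of low energy\<close>

definition trapezoid :: "nat \<Rightarrow> real \<Rightarrow> real" where
  "trapezoid m x = max 0 (min 1 (2 - \<bar>x\<bar> / 4 ^ m))"

lemma trapezoid_bounds: "0 \<le> trapezoid m x" "trapezoid m x \<le> 1"
  by (auto simp: trapezoid_def)

lemma trapezoid_eq_1: "\<bar>x\<bar> \<le> 4 ^ m \<Longrightarrow> trapezoid m x = 1"
  by (simp add: trapezoid_def field_simps)

lemma trapezoid_eq_0: "2 * 4 ^ m < \<bar>x\<bar> \<Longrightarrow> trapezoid m x = 0"
  by (simp add: trapezoid_def field_simps)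

lemma trapezoid_diff_le: "\<bar>trapezoid m x - trapezoid m y\<bar> \<le> min 1 (\<bar>x - y\<bar> / 4 ^ m)"
proof -
  have "\<bar>max 0 (min 1 a) - max 0 (min 1 b)\<bar> \<le> \<bar>a - b\<bar>" for a b :: real by linarith
  then have "\<bar>trapezoid m x - trapezoid m y\<bar> \<le> \<bar>(2 - \<bar>x\<bar> / 4 ^ m) - (2 - \<bar>y\<bar> / 4 ^ m)\<bar>"
    unfolding trapezoid_def .
  also have "\<dots> = \<bar>\<bar>x\<bar> - \<bar>y\<bar>\<bar> / 4 ^ m" by (simp add: abs_minus_commute flip: diff_divide_distrib)
  also have "\<dots> \<le> \<bar>x - y\<bar> / 4 ^ m" by (intro divide_right_mono) auto
  finally have "\<bar>trapezoid m x - trapezoid m y\<bar> \<le> \<bar>x - y\<bar> / 4 ^ m" .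
  moreover have "\<bar>trapezoid m x - trapezoid m y\<bar> \<le> 1"
    using trapezoid_bounds[of m x] trapezoid_bounds[of m y] by linarith
  ultimately show ?thesis by simp
qed

lemma trapezoid_measurable [measurable]: "trapezoid m \<in> borel_measurable borel"
  unfolding trapezoid_def by measurable

text \<open>The increment is at most \<open>min 1 (\<bar>t\<bar> / 4 ^ m)\<close> in modulus and
  vanishes outside \<open>?S\<close> and \<open>?T\<close>, two intervals of length
  \<open>4 * 4 ^ m\<close> each; hence the factor 8.\<close>

lemma trapezoid_increment:
  defines "c \<equiv> \<lambda>m t. (min 1 (\<bar>t\<bar> / 4 ^ m))\<^sup>2 :: real"
  shows "integrable lborel (\<lambda>x. (trapezoid m (x + t) - trapezoid m x)\<^sup>2)"
    and "(\<integral>x. (trapezoid m (x + t) - trapezoid m x)\<^sup>2 \<partial>lborel) \<le> 8 * 4 ^ m * c m t"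
proof -
  let ?S = "{- (2 * 4 ^ m)..2 * 4 ^ m} :: real set"
  let ?T = "{- (2 * 4 ^ m) - t..2 * 4 ^ m - t} :: real set"
  let ?g = "\<lambda>x. c m t * (indicator ?S x + indicator ?T x)"
  have int: "integrable lborel ?g"
    by (intro integrable_mult_right Bochner_Integration.integrable_add integrable_real_indicator)
      (auto simp: emeasure_lborel_Icc_eq)
  have le: "(trapezoid m (x + t) - trapezoid m x)\<^sup>2 \<le> ?g x" for x
  proof (cases "x \<in> ?S \<or> x \<in> ?T")
    case True
    have "(trapezoid m (x + t) - trapezoid m x)\<^sup>2 \<le> c m t"
      using trapezoid_diff_le[of m "x + t" x] unfolding c_def
      by (subst power2_abs[symmetric]) (intro power_mono, auto)
    also have "c m t * 1 \<le> ?g x"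
      using True by (intro mult_left_mono) (auto simp: indicator_def c_def)
    finally show ?thesis by simp
  next
    case False
    then have "trapezoid m x = 0" "trapezoid m (x + t) = 0"
      by (auto intro!: trapezoid_eq_0)
    then show ?thesis by (simp add: c_def)
  qed
  show "integrable lborel (\<lambda>x. (trapezoid m (x + t) - trapezoid m x)\<^sup>2)"
  proof (rule Bochner_Integration.integrable_bound[OF int])
    show "AE x in lborel. norm ((trapezoid m (x + t) - trapezoid m x)\<^sup>2) \<le> norm (?g x)"
    proof (rule AE_I2)
      show "norm ((trapezoid m (x + t) - trapezoid m x)\<^sup>2) \<le> norm (?g x)" for x
        using order_trans[OF le[of x] abs_ge_self] by simp
    qed
  qed measurable
  have "(\<integral>x. (trapezoid m (x + t) - trapezoid m x)\<^sup>2 \<partial>lborel) \<le> (\<integral>x. ?g x \<partial>lborel)"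
    using int le by (intro integral_mono') (auto simp: c_def)
  also have "\<dots> = c m t * (measure lborel ?S + measure lborel ?T)"
    by (subst integral_mult_right_zero, subst Bochner_Integration.integral_add)
      (auto simp: emeasure_lborel_Icc_eq intro!: integrable_real_indicator)
  also have "\<dots> = 8 * 4 ^ m * c m t" by simp
  finally show "(\<integral>x. (trapezoid m (x + t) - trapezoid m x)\<^sup>2 \<partial>lborel) \<le> 8 * 4 ^ m * c m t" .
qed

section \<open>Averaging over scales\<close>

text \<open>Discrete version of the logarithmic cutoff: between \<open>4 ^ M\<close> and
  \<open>4 ^ (2 * M)\<close> it is close to \<open>2 - log 4 \<bar>x\<bar> / M\<close>.\<close>

definition log_cutoff :: "nat \<Rightarrow> real \<Rightarrow> real" where
  "log_cutoff M x = (\<Sum>m = M..<2 * M. trapezoid m x) / real M"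

text \<open>Up to the factor \<open>sqrt 8\<close>, the sum of the bounds of
  \<open>trapezoid_increment\<close> on the norms of the single increments.\<close>

definition cutoff_modulus :: "nat \<Rightarrow> real \<Rightarrow> real" where
  "cutoff_modulus M t = (\<Sum>m = M..<2 * M. 2 ^ m * min 1 (\<bar>t\<bar> / 4 ^ m))"

lemma cutoff_modulus_nonneg: "0 \<le> cutoff_modulus M t"
  unfolding cutoff_modulus_def by (intro sum_nonneg) auto

lemma log_cutoff_bounds: "0 \<le> log_cutoff M x" "log_cutoff M x \<le> 1"
proof -
  show "0 \<le> log_cutoff M x"
    unfolding log_cutoff_def by (intro divide_nonneg_nonneg sum_nonneg trapezoid_bounds) auto
  have "(\<Sum>m = M..<2 * M. trapezoid m x) \<le> (\<Sum>m = M..<2 * M. 1)"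
    by (intro sum_mono trapezoid_bounds)
  then show "log_cutoff M x \<le> 1" unfolding log_cutoff_def by (auto simp: divide_le_eq_1)
qed

lemma log_cutoff_eq_1:
  assumes "1 \<le> M" "\<bar>x\<bar> \<le> 4 ^ M"
  shows "log_cutoff M x = 1"
proof -
  have "trapezoid m x = 1" if "m \<in> {M..<2 * M}" for m
    using assms(2) that by (intro trapezoid_eq_1 order_trans[OF assms(2)] power_increasing) auto
  then show ?thesis using assms(1) by (simp add: log_cutoff_def)
qed

lemma test_function_log_cutoff: "test_function (log_cutoff M)"
  unfolding test_function_def
proof (intro conjI exI[of _ "2 * 4 ^ (2 * M)"] allI impI)
  show "log_cutoff M \<in> borel_measurable borel" unfolding log_cutoff_def[abs_def] by measurable
  show "bounded (range (log_cutoff M))"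
    unfolding bounded_iff using log_cutoff_bounds by (intro exI[of _ 1]) auto
  fix x assume "log_cutoff M x \<noteq> 0"
  then obtain m where m: "m \<in> {M..<2 * M}" "trapezoid m x \<noteq> 0"
    unfolding log_cutoff_def by (metis (mono_tags, lifting) div_0 sum.neutral)
  then have "\<bar>x\<bar> \<le> 2 * 4 ^ m" using trapezoid_eq_0[of m x] by force
  also have "\<dots> \<le> 2 * 4 ^ (2 * M)" using m(1) by (intro mult_left_mono power_increasing) auto
  finally show "\<bar>x\<bar> \<le> 2 * 4 ^ (2 * M)" .
qed

text \<open>The \<open>L\<^sup>2\<close> triangle inequality for the sum over scales, as a Cauchy--Schwarz inequality
  weighted by the norms of the summands.\<close>

lemma log_cutoff_increment:
  "(\<integral>x. (log_cutoff M (x + t) - log_cutoff M x)\<^sup>2 \<partial>lborel) \<le> 8 * (cutoff_modulus M t)\<^sup>2 / (real M)\<^sup>2"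
proof (cases "t = 0")
  case False
  define w where "w m = 2 ^ m * min 1 (\<bar>t\<bar> / 4 ^ m)" for m
  define u where "u m x = trapezoid m (x + t) - trapezoid m x" for m x
  let ?I = "{M..<2 * M}"
  let ?W = "cutoff_modulus M t"
  \<comment> \<open>For t = 0 both sides vanish; otherwise the weights are positive and can stand in
    denominators.\<close>
  have w: "0 < w m" for m using False by (simp add: w_def min_def)
  have W: "?W = (\<Sum>m\<in>?I. w m)" by (simp add: cutoff_modulus_def w_def)
  have int: "integrable lborel (\<lambda>x. (u m x)\<^sup>2 / w m)" for m
    unfolding u_def by (intro integrable_divide trapezoid_increment)
  have u2: "(\<integral>x. (u m x)\<^sup>2 / w m \<partial>lborel) \<le> 8 * w m" for m
  proof -
    have "4 ^ m * (min 1 (\<bar>t\<bar> / 4 ^ m))\<^sup>2 = (w m)\<^sup>2"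
      by (simp add: w_def power_mult_distrib power_even_eq[symmetric] power_mult[symmetric] mult.commute[of m] power_mult[of 2 2])
    then have "(\<integral>x. (u m x)\<^sup>2 \<partial>lborel) \<le> 8 * (w m)\<^sup>2"
      using trapezoid_increment(2)[of m t] by (simp add: u_def)
    then have "(\<integral>x. (u m x)\<^sup>2 \<partial>lborel) / w m \<le> 8 * (w m)\<^sup>2 / w m"
      using w[of m] by (intro divide_right_mono) auto
    then show ?thesis using w[of m] by (simp add: power2_eq_square)
  qed
  have CS: "(\<Sum>m\<in>?I. u m x)\<^sup>2 \<le> ?W * (\<Sum>m\<in>?I. (u m x)\<^sup>2 / w m)" for x
  proof -
    have "(\<Sum>m\<in>?I. sqrt (w m) * (u m x / sqrt (w m)))\<^sup>2 \<le>
        (\<Sum>m\<in>?I. (sqrt (w m))\<^sup>2) * (\<Sum>m\<in>?I. (u m x / sqrt (w m))\<^sup>2)"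
      by (rule Cauchy_Schwarz_ineq_sum)
    moreover have "sqrt (w m) * (u m x / sqrt (w m)) = u m x" "(sqrt (w m))\<^sup>2 = w m"
      "(u m x / sqrt (w m))\<^sup>2 = (u m x)\<^sup>2 / w m" for m
      using w[of m] by (auto simp: power_divide)
    ultimately show ?thesis by (simp add: W)
  qed
  have eq: "(log_cutoff M (x + t) - log_cutoff M x)\<^sup>2 = (\<Sum>m\<in>?I. u m x)\<^sup>2 / (real M)\<^sup>2" for x
    by (simp add: log_cutoff_def u_def sum_subtractf power_divide flip: diff_divide_distrib)
  have "(\<integral>x. (log_cutoff M (x + t) - log_cutoff M x)\<^sup>2 \<partial>lborel) \<le>
      (\<integral>x. ?W * (\<Sum>m\<in>?I. (u m x)\<^sup>2 / w m) / (real M)\<^sup>2 \<partial>lborel)"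
  proof (rule integral_mono')
    show "integrable lborel (\<lambda>x. ?W * (\<Sum>m\<in>?I. (u m x)\<^sup>2 / w m) / (real M)\<^sup>2)"
      by (intro integrable_divide integrable_mult_right Bochner_Integration.integrable_sum int)
    show "(log_cutoff M (x + t) - log_cutoff M x)\<^sup>2 \<le> ?W * (\<Sum>m\<in>?I. (u m x)\<^sup>2 / w m) / (real M)\<^sup>2" for x
      unfolding eq by (intro divide_right_mono CS) auto
    show "0 \<le> ?W * (\<Sum>m\<in>?I. (u m x)\<^sup>2 / w m) / (real M)\<^sup>2" for x
      using w by (intro divide_nonneg_nonneg mult_nonneg_nonneg sum_nonneg cutoff_modulus_nonneg) (auto intro: less_imp_le)
  qed
  also have "\<dots> = ?W * (\<Sum>m\<in>?I. \<integral>x. (u m x)\<^sup>2 / w m \<partial>lborel) / (real M)\<^sup>2"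
    by (simp only: integral_divide_zero integral_mult_right_zero Bochner_Integration.integral_sum[OF int])
  also have "\<dots> \<le> ?W * (\<Sum>m\<in>?I. 8 * w m) / (real M)\<^sup>2"
    by (intro divide_right_mono mult_left_mono sum_mono u2 cutoff_modulus_nonneg) auto
  also have "\<dots> = 8 * ?W\<^sup>2 / (real M)\<^sup>2"
    by (simp add: W power2_eq_square flip: sum_distrib_left)
  finally show ?thesis .
qed simp

text \<open>Saturation for large |t|: the summand of scale m never exceeds \<open>2 ^ m\<close>. The
  square of the bound is the \<open>16 ^ M\<close> of \<open>weighted_scale_sum\<close>.\<close>

lemma cutoff_modulus_le_power: "cutoff_modulus M t \<le> 4 ^ M"
proof -
  have "cutoff_modulus M t \<le> (\<Sum>m = M..<2 * M. 2 ^ m)"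
    unfolding cutoff_modulus_def by (intro sum_mono) simp
  also have "\<dots> \<le> (\<Sum>m<2 * M. 2 ^ m)" by (intro sum_mono2) auto
  also have "\<dots> \<le> 2 ^ (2 * M)" by (simp add: sum_gp_strict)
  also have "(2::real) ^ (2 * M) = 4 ^ M" by (simp add: power_mult)
  finally show ?thesis .
qed

text \<open>Scales \<open>m \<le> s\<close> saturate and sum to at most \<open>2 * 2 ^ s\<close>;
  for larger m the summands are at most \<open>4 * 4 ^ s / 2 ^ m\<close>, with sum at most
  \<open>4 * 2 ^ s\<close>. Independence of M is the gain from averaging: the sum over M scales
  costs no more than the scale nearest to |t|, while the average is divided by M.\<close>

lemma cutoff_modulus_le_scale:
  assumes "\<bar>t\<bar> \<le> 4 ^ Suc s"
  shows "cutoff_modulus M t \<le> 6 * 2 ^ s"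
proof -
  let ?lo = "\<lambda>m. if m \<le> s then 2 ^ m else 0 :: real"
  let ?hi = "\<lambda>m. if m \<le> s then 0 else 1 / 2 ^ m :: real"
  have lo: "(\<Sum>m<N. ?lo m) \<le> 2 * 2 ^ s" for N
  proof -
    have "(\<Sum>m<N. ?lo m) = (\<Sum>m\<in>{..<N} \<inter> {..s}. 2 ^ m)" by (subst sum.inter_restrict) auto
    also have "\<dots> \<le> (\<Sum>m\<le>s. 2 ^ m)" by (intro sum_mono2) auto
    also have "\<dots> \<le> 2 * 2 ^ s" by (simp add: sum_gp0)
    finally show ?thesis by simp
  qed
  \<comment> \<open>The induction carries the exact remainder of the geometric series along.\<close>
  have hi: "(\<Sum>m<N. ?hi m) + (if N \<le> s then 0 else 2 / 2 ^ N) \<le> 1 / 2 ^ s" for N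
  proof (induction N)
    case (Suc N)
    then show ?case by (cases N s rule: linorder_cases) auto
  qed simp
  have summand: "2 ^ m * min 1 (\<bar>t\<bar> / 4 ^ m) \<le> ?lo m + 4 * 4 ^ s * ?hi m" for m
  proof (cases "m \<le> s")
    case False
    have "2 ^ m * min 1 (\<bar>t\<bar> / 4 ^ m) \<le> 2 ^ m * (4 ^ Suc s / 4 ^ m)"
      using assms by (intro mult_left_mono min.coboundedI2 divide_right_mono) auto
    also have "\<dots> = 4 * 4 ^ s * (1 / 2 ^ m)"
    proof -
      have "(4::real) ^ m = 2 ^ m * 2 ^ m" by (simp flip: power_mult_distrib)
      then show ?thesis by simp
    qed
    finally show ?thesis using False by simp
  qed simp
  have "cutoff_modulus M t \<le> (\<Sum>m<2 * M. 2 ^ m * min 1 (\<bar>t\<bar> / 4 ^ m))"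
    unfolding cutoff_modulus_def by (intro sum_mono2) auto
  also have "\<dots> \<le> (\<Sum>m<2 * M. ?lo m + 4 * 4 ^ s * ?hi m)" by (intro sum_mono summand)
  also have "\<dots> = (\<Sum>m<2 * M. ?lo m) + 4 * 4 ^ s * (\<Sum>m<2 * M. ?hi m)"
    by (simp only: sum.distrib sum_distrib_left)
  also have "\<dots> \<le> 2 * 2 ^ s + 4 * 4 ^ s * (1 / 2 ^ s)"
  proof (intro add_mono mult_left_mono)
    show "(\<Sum>m<2 * M. ?lo m) \<le> 2 * 2 ^ s" using lo[of "2 * M"] by simp
    have "0 \<le> (if 2 * M \<le> s then 0 else 2 / 2 ^ (2 * M) :: real)" by simp
    then show "(\<Sum>m<2 * M. ?hi m) \<le> 1 / 2 ^ s" using hi[of "2 * M"] by linarith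
  qed auto
  also have "(4::real) ^ s = 2 ^ s * 2 ^ s" by (simp flip: power_mult_distrib)
  then have "2 * 2 ^ s + 4 * 4 ^ s * (1 / 2 ^ s) = (6 * 2 ^ s :: real)" by simp
  finally show ?thesis .
qed

section \<open>Summation over the shells
  \<open>4 ^ s \<le> \<bar>t\<bar> < 4 ^ Suc s\<close>\<close>

text \<open>Each shell is enlarged to the interval \<open>?S s\<close> of length
  \<open>8 * 4 ^ s\<close>, and the core to [-1,1]. This serves twice: for the integrability of k
  and for the energy.\<close>

lemma nn_integral_shells_le:
  fixes h :: "real \<Rightarrow> real" and c :: "nat \<Rightarrow> real"
  assumes b: "0 \<le> b" "\<And>t. \<bar>t\<bar> < 1 \<Longrightarrow> h t \<le> b"
    and c: "\<And>s. 0 \<le> c s" "\<And>s t. 4 ^ s \<le> \<bar>t\<bar> \<Longrightarrow> \<bar>t\<bar> < 4 ^ Suc s \<Longrightarrow> h t \<le> c s"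
    and sum: "summable (\<lambda>s. 4 ^ s * c s)"
  shows "(\<integral>\<^sup>+t. ennreal (h t) \<partial>lborel) \<le> ennreal (2 * b + 8 * (\<Sum>s. 4 ^ s * c s))"
proof -
  let ?S = "\<lambda>s. {- (4 ^ Suc s)..4 ^ Suc s} :: real set"
  let ?g = "\<lambda>t. ennreal b * indicator {-1..1::real} t + (\<Sum>s. ennreal (c s) * indicator (?S s) t)"
  have "ennreal (h t) \<le> ?g t" for t
  proof (cases "\<bar>t\<bar> < 1")
    case True
    then have "t \<in> {-1..1}" by auto
    then have "ennreal (h t) \<le> ennreal b * indicator {-1..1::real} t"
      using b(2)[OF True] by (simp add: ennreal_leI)
    also have "\<dots> \<le> ?g t" by simp
    finally show ?thesis .
  next
    case False
    define n where "n = (LEAST n. \<bar>t\<bar> < 4 ^ n)"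
    have "\<exists>n. \<bar>t\<bar> < 4 ^ n" by (rule real_arch_pow) simp
    then have n: "\<bar>t\<bar> < 4 ^ n" unfolding n_def by (rule LeastI_ex)
    with False obtain s where s: "n = Suc s" by (cases n) auto
    have "\<not> \<bar>t\<bar> < 4 ^ s" using not_less_Least[of s "\<lambda>n. \<bar>t\<bar> < 4 ^ n"] s by (simp add: n_def)
    then have "h t \<le> c s" using c(2)[of s t] n s by simp
    then have "ennreal (h t) \<le> ennreal (c s) * indicator (?S s) t"
      using n s by (auto simp: indicator_def intro!: ennreal_leI)
    also have "\<dots> \<le> (\<Sum>s. ennreal (c s) * indicator (?S s) t)"
    proof -
      have "F s \<le> suminf F" for F :: "nat \<Rightarrow> ennreal" using sum_le_suminf[of F "{s}"] by simp
      then show ?thesis .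
    qed
    also have "\<dots> \<le> ?g t" by simp
    finally show ?thesis .
  qed
  then have "(\<integral>\<^sup>+t. ennreal (h t) \<partial>lborel) \<le> (\<integral>\<^sup>+t. ?g t \<partial>lborel)" by (intro nn_integral_mono)
  also have "\<dots> = (\<integral>\<^sup>+t. ennreal b * indicator {-1..1::real} t \<partial>lborel) +
      (\<integral>\<^sup>+t. (\<Sum>s. ennreal (c s) * indicator (?S s) t) \<partial>lborel)"
    by (rule nn_integral_add) auto
  also have "(\<integral>\<^sup>+t. ennreal b * indicator {-1..1::real} t \<partial>lborel) = ennreal b * ennreal 2"
    by (subst nn_integral_cmult_indicator) (auto simp: emeasure_lborel_Icc_eq)
  also have "\<dots> = ennreal (2 * b)"
    by (subst ennreal_mult'[OF b(1), symmetric]) (simp add: mult.commute)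
  also have "(\<integral>\<^sup>+t. (\<Sum>s. ennreal (c s) * indicator (?S s) t) \<partial>lborel) =
      (\<Sum>s. \<integral>\<^sup>+t. ennreal (c s) * indicator (?S s) t \<partial>lborel)"
    by (intro nn_integral_suminf) auto
  also have "\<dots> = (\<Sum>s. ennreal (8 * (4 ^ s * c s)))"
  proof (intro suminf_cong)
    fix s
    have "(\<integral>\<^sup>+t. ennreal (c s) * indicator (?S s) t \<partial>lborel) = ennreal (c s) * ennreal (8 * 4 ^ s)"
      by (subst nn_integral_cmult_indicator) (auto simp: emeasure_lborel_Icc_eq)
    also have "\<dots> = ennreal (8 * (4 ^ s * c s))"
      by (subst ennreal_mult'[OF c(1), symmetric]) (simp add: mult_ac)
    finally show "(\<integral>\<^sup>+t. ennreal (c s) * indicator (?S s) t \<partial>lborel) = ennreal (8 * (4 ^ s * c s))" .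
  qed
  also have "\<dots> = ennreal (8 * (\<Sum>s. 4 ^ s * c s))"
    using c(1) sum by (subst suminf_ennreal2) (auto simp: suminf_mult summable_mult)
  also have "ennreal (2 * b) + ennreal (8 * (\<Sum>s. 4 ^ s * c s)) = ennreal (2 * b + 8 * (\<Sum>s. 4 ^ s * c s))"
    using b(1) c(1) sum by (subst ennreal_plus) (auto intro!: suminf_nonneg)
  finally show ?thesis .
qed

text \<open>Apart from constants, \<open>a M s\<close> is the share of shell s in
  \<open>M\<^sup>2\<close> times the energy; 36 and \<open>16 ^ M\<close> are the squares of the
  bounds \<open>6 * 2 ^ s\<close>, divided by \<open>4 ^ s\<close>, and \<open>4 ^ M\<close>. The
  first \<open>2 * M\<close> terms dominate and account for the exponent
  \<open>1 + \<theta>\<close>.\<close>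

lemma weighted_scale_sum:
  assumes theta: "0 < \<theta>" "\<theta> < 1"
  defines "a \<equiv> \<lambda>M s. (1 + real s) powr \<theta> * min 36 (16 ^ M / 4 ^ s)"
  shows "summable (a M)" and "suminf (a M) \<le> 36 * (1 + 2 * real M) powr (1 + \<theta>) + 2 * (1 + 2 * real M)"
proof -
  have nonneg: "0 \<le> a M s" for s by (simp add: a_def)
  \<comment> \<open>With \<open>s = r + 2 * M\<close> the minimum is at most
    \<open>(1 / 4) ^ r\<close>, against a growth of at most
    \<open>(1 + 2 * M) * 2 ^ r\<close>.\<close>
  have tail: "a M (r + 2 * M) \<le> (1 + 2 * real M) * (1 / 2) ^ r" for r
  proof -
    have "(1 + real (r + 2 * M)) powr \<theta> \<le> (1 + real (r + 2 * M)) powr 1"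
      using theta by (intro powr_mono) auto
    also have "\<dots> = 1 + real (r + 2 * M)" by simp
    also have "\<dots> \<le> (1 + 2 * real M) * (1 + real r)" by (simp add: algebra_simps)
    also have "\<dots> \<le> (1 + 2 * real M) * 2 ^ r"
    proof -
      have "1 + r \<le> 2 ^ r" by (induction r) auto
      then have "real (1 + r) \<le> real (2 ^ r)" by (simp only: of_nat_le_iff)
      then show ?thesis by (intro mult_left_mono) auto
    qed
    finally have "(1 + real (r + 2 * M)) powr \<theta> \<le> (1 + 2 * real M) * 2 ^ r" .
    moreover have "16 ^ M / 4 ^ (r + 2 * M) = (1 / 4 :: real) ^ r"
      by (simp add: power_add power_mult power_divide)
    ultimately have "a M (r + 2 * M) \<le> ((1 + 2 * real M) * 2 ^ r) * (1 / 4) ^ r"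
      unfolding a_def by (intro mult_mono) auto
    also have "\<dots> = (1 + 2 * real M) * (1 / 2) ^ r"
      by (simp add: mult.assoc flip: power_mult_distrib)
    finally show ?thesis .
  qed
  have geo: "summable (\<lambda>r. (1 + 2 * real M) * (1 / 2) ^ r)" by (intro summable_mult summable_geometric) simp
  then have "summable (\<lambda>r. a M (r + 2 * M))"
    using tail nonneg by (intro summable_comparison_test'[OF geo, of 0]) auto
  then show sum: "summable (a M)" by (simp only: summable_iff_shift)
  have "suminf (a M) = (\<Sum>r. a M (r + 2 * M)) + (\<Sum>s<2 * M. a M s)"
    by (rule suminf_split_initial_segment[OF sum])
  also have "(\<Sum>r. a M (r + 2 * M)) \<le> (\<Sum>r. (1 + 2 * real M) * (1 / 2) ^ r)"
    using tail geo \<open>summable (\<lambda>r. a M (r + 2 * M))\<close> by (intro suminf_le) auto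
  also have "\<dots> = 2 * (1 + 2 * real M)"
    by (subst suminf_mult) (auto simp: suminf_geometric)
  also have "(\<Sum>s<2 * M. a M s) \<le> (\<Sum>s<2 * M. 36 * (1 + 2 * real M) powr \<theta>)"
  proof (intro sum_mono)
    fix s assume "s \<in> {..<2 * M}"
    then have "(1 + real s) powr \<theta> \<le> (1 + 2 * real M) powr \<theta>" using theta by (intro powr_mono2) auto
    then have "a M s \<le> (1 + 2 * real M) powr \<theta> * 36" unfolding a_def by (intro mult_mono) auto
    then show "a M s \<le> 36 * (1 + 2 * real M) powr \<theta>" by (simp add: mult.commute)
  qed
  also have "\<dots> = 36 * (2 * real M * (1 + 2 * real M) powr \<theta>)" by simp
  also have "\<dots> \<le> 36 * ((1 + 2 * real M) * (1 + 2 * real M) powr \<theta>)"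
    by (intro mult_left_mono mult_right_mono) auto
  also have "\<dots> = 36 * (1 + 2 * real M) powr (1 + \<theta>)" by (simp add: powr_add)
  finally show "suminf (a M) \<le> 36 * (1 + 2 * real M) powr (1 + \<theta>) + 2 * (1 + 2 * real M)" by simp
qed

lemma integrable_shell_decay:
  fixes k :: "real \<Rightarrow> real"
  assumes [measurable]: "k \<in> borel_measurable borel"
    and k: "\<And>t. 0 \<le> k t" "\<And>t. k t \<le> 1"
    and theta: "0 < \<theta>" "\<theta> < 1" and D: "0 \<le> D"
    and decay: "\<And>s t. 4 ^ s \<le> \<bar>t\<bar> \<Longrightarrow> k t \<le> D * (1 + real s) powr \<theta> / 16 ^ s"
  shows "integrable lborel k"
proof -
  let ?c = "\<lambda>s. D * (1 + real s) powr \<theta> / 16 ^ s"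
  \<comment> \<open>For M = 0 the minimum is just \<open>1 / 4 ^ s\<close>, so the summability
    proved for the energy also covers k itself.\<close>
  have le: "4 ^ s * ?c s \<le> D * ((1 + real s) powr \<theta> * min 36 (16 ^ 0 / 4 ^ s))" for s
  proof -
    have "(16::real) ^ s = 4 ^ s * 4 ^ s" by (simp flip: power_mult_distrib)
    moreover have "1 / 4 ^ s \<le> (36::real)" by (rule order_trans[of _ 1]) auto
    ultimately show ?thesis by simp
  qed
  have "summable (\<lambda>s. 4 ^ s * ?c s)"
    by (rule summable_comparison_test'[OF summable_mult[OF weighted_scale_sum(1)[OF theta, of 0], of D], of 0])
      (use le D in auto)
  then have "(\<integral>\<^sup>+t. ennreal (k t) \<partial>lborel) \<le> ennreal (2 * 1 + 8 * (\<Sum>s. 4 ^ s * ?c s))"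
    using k decay D by (intro nn_integral_shells_le) auto
  also have "\<dots> < \<infinity>" by simp
  finally show ?thesis using k by (intro integrableI_nonneg) auto
qed

text \<open>On shell s the decay of k meets both bounds on the modulus. The constant 72 is 2 * 36:
  on the core k is at most 1, the modulus at most 6, and [-1,1] has length 2.\<close>

lemma log_cutoff_energy_le:
  fixes k :: "real \<Rightarrow> real"
  assumes k: "\<And>t. 0 \<le> k t" "\<And>t. k t \<le> 1"
    and theta: "0 < \<theta>" "\<theta> < 1" and D: "0 \<le> D"
    and decay: "\<And>s t. 4 ^ s \<le> \<bar>t\<bar> \<Longrightarrow> k t \<le> D * (1 + real s) powr \<theta> / 16 ^ s"
  shows "(\<integral>t. k t * (\<integral>x. (log_cutoff M (x + t) - log_cutoff M x)\<^sup>2 \<partial>lborel) \<partial>lborel) \<le>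
    8 / (real M)\<^sup>2 * (72 + 8 * D * (36 * (1 + 2 * real M) powr (1 + \<theta>) + 2 * (1 + 2 * real M)))"
proof -
  let ?W = "cutoff_modulus M"
  let ?a = "\<lambda>s. (1 + real s) powr \<theta> * min 36 (16 ^ M / 4 ^ s)"
  let ?c = "\<lambda>s. 8 / (real M)\<^sup>2 * (D * (1 + real s) powr \<theta> / 16 ^ s * min (36 * 4 ^ s) (16 ^ M))"
  let ?h = "\<lambda>t. k t * (\<integral>x. (log_cutoff M (x + t) - log_cutoff M x)\<^sup>2 \<partial>lborel)"
  let ?B = "72 + 8 * D * (36 * (1 + 2 * real M) powr (1 + \<theta>) + 2 * (1 + 2 * real M))"
  have h_le: "?h t \<le> 8 / (real M)\<^sup>2 * (k t * (?W t)\<^sup>2)" for t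
    using mult_left_mono[OF log_cutoff_increment[of M t] k(1)[of t]] by (simp add: mult_ac)
  have c: "4 ^ s * ?c s = 8 / (real M)\<^sup>2 * (D * ?a s)" for s
  proof -
    have "4 ^ s * (min (36 * 4 ^ s) (16 ^ M) / 16 ^ s) = min 36 (16 ^ M / 4 ^ s :: real)"
    proof -
      have "(16::real) ^ s = 4 ^ s * 4 ^ s" by (simp flip: power_mult_distrib)
      then have "4 ^ s * (min (36 * 4 ^ s) (16 ^ M) / 16 ^ s) = min (36 * 4 ^ s) (16 ^ M) / (4 ^ s :: real)" by simp
      also have "\<dots> = min 36 (16 ^ M / 4 ^ s)" by (simp add: min_divide_distrib_right)
      finally show ?thesis .
    qed
    moreover have "u * (K * (D * p / q * X)) = K * (D * (p * (u * (X / q))))" for u K p q X :: real by simp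
    ultimately show ?thesis by (simp only:)
  qed
  note sum = weighted_scale_sum[OF theta, of M]
  have "(\<integral>\<^sup>+t. ennreal (?h t) \<partial>lborel) \<le> ennreal (2 * (8 / (real M)\<^sup>2 * 36) + 8 * (\<Sum>s. 4 ^ s * ?c s))"
  proof (rule nn_integral_shells_le)
    show "?h t \<le> 8 / (real M)\<^sup>2 * 36" if "\<bar>t\<bar> < 1" for t
    proof -
      have "(?W t)\<^sup>2 \<le> 6\<^sup>2"
        using that cutoff_modulus_le_scale[of t 0 M] by (intro power_mono cutoff_modulus_nonneg) auto
      then have "k t * (?W t)\<^sup>2 \<le> 1 * 36" using k[of t] by (intro mult_mono) auto
      then have "8 / (real M)\<^sup>2 * (k t * (?W t)\<^sup>2) \<le> 8 / (real M)\<^sup>2 * 36" by (intro mult_left_mono) auto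
      with h_le[of t] show ?thesis by linarith
    qed
    show "?h t \<le> ?c s" if "4 ^ s \<le> \<bar>t\<bar>" "\<bar>t\<bar> < 4 ^ Suc s" for s t
    proof -
      have "(?W t)\<^sup>2 \<le> (6 * 2 ^ s)\<^sup>2"
        using that by (intro power_mono cutoff_modulus_nonneg cutoff_modulus_le_scale) auto
      also have "\<dots> = 36 * 4 ^ s" by (simp add: power_mult_distrib flip: power_mult) (simp add: power_mult mult.commute[of s])
      finally have "(?W t)\<^sup>2 \<le> 36 * 4 ^ s" .
      moreover have "(?W t)\<^sup>2 \<le> (4 ^ M)\<^sup>2"
        by (intro power_mono cutoff_modulus_nonneg cutoff_modulus_le_power)
      then have "(?W t)\<^sup>2 \<le> 16 ^ M" by (simp add: power2_eq_square flip: power_mult_distrib)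
      ultimately have "k t * (?W t)\<^sup>2 \<le> D * (1 + real s) powr \<theta> / 16 ^ s * min (36 * 4 ^ s) (16 ^ M)"
        using decay[OF that(1)] D by (intro mult_mono) auto
      then have "8 / (real M)\<^sup>2 * (k t * (?W t)\<^sup>2) \<le> ?c s" by (intro mult_left_mono) auto
      with h_le[of t] show ?thesis by linarith
    qed
    show "summable (\<lambda>s. 4 ^ s * ?c s)" unfolding c by (intro summable_mult sum(1))
  qed (use D in auto)
  also have "\<dots> \<le> ennreal (8 / (real M)\<^sup>2 * ?B)"
  proof (rule ennreal_leI)
    have "(\<Sum>s. 4 ^ s * ?c s) = 8 / (real M)\<^sup>2 * (D * (\<Sum>s. ?a s))"
      unfolding c by (simp only: suminf_mult[OF summable_mult[OF sum(1)]] suminf_mult[OF sum(1)])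
    also have "\<dots> \<le> 8 / (real M)\<^sup>2 * (D * (36 * (1 + 2 * real M) powr (1 + \<theta>) + 2 * (1 + 2 * real M)))"
      using sum(2) D by (intro mult_left_mono) auto
    finally have le: "(\<Sum>s. 4 ^ s * ?c s) \<le>
      8 / (real M)\<^sup>2 * (D * (36 * (1 + 2 * real M) powr (1 + \<theta>) + 2 * (1 + 2 * real M)))" .
    have "2 * (K * 36) + 8 * S \<le> K * (72 + 8 * D * Y)" if "S \<le> K * (D * Y)" for S K Y :: real
      using that by (simp add: algebra_simps)
    from this[OF le] show "2 * (8 / (real M)\<^sup>2 * 36) + 8 * (\<Sum>s. 4 ^ s * ?c s) \<le> 8 / (real M)\<^sup>2 * ?B" .
  qed
  finally show ?thesis using D by (intro integral_real_bounded) auto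
qed

lemma exists_low_energy_cutoff:
  fixes k :: "real \<Rightarrow> real"
  assumes k: "\<And>t. 0 \<le> k t" "\<And>t. k t \<le> 1"
    and theta: "0 < \<theta>" "\<theta> < 1" and D: "0 \<le> D"
    and decay: "\<And>s t. 4 ^ s \<le> \<bar>t\<bar> \<Longrightarrow> k t \<le> D * (1 + real s) powr \<theta> / 16 ^ s"
    and e: "0 < e"
  shows "\<exists>f. test_function f \<and> (\<forall>x. 0 \<le> f x) \<and> (\<forall>x. \<bar>x\<bar> \<le> R \<longrightarrow> f x = 1) \<and>
    (\<integral>t. k t * (\<integral>x. (f (x + t) - f x)\<^sup>2 \<partial>lborel) \<partial>lborel) \<le> e"
proof -
  let ?b = "\<lambda>M. 8 / (real M)\<^sup>2 * (72 + 8 * D * (36 * (1 + 2 * real M) powr (1 + \<theta>) + 2 * (1 + 2 * real M)))"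
  \<comment> \<open>The leading term is of order \<open>M powr (1 + \<theta>) / M\<^sup>2\<close>;
    here \<open>\<theta> < 1\<close> is decisive.\<close>
  have "?b \<longlonglongrightarrow> 0" using theta by real_asymp
  then have "\<forall>\<^sub>F M in sequentially. ?b M < e" using e by (rule order_tendstoD)
  moreover have "\<forall>\<^sub>F M in sequentially. R \<le> 4 ^ M"
    by real_asymp
  moreover have "\<forall>\<^sub>F M in sequentially. 1 \<le> M" by (rule eventually_ge_at_top)
  ultimately have "\<forall>\<^sub>F M in sequentially. ?b M < e \<and> R \<le> 4 ^ M \<and> 1 \<le> M" by eventually_elim simp
  then obtain M where M: "?b M < e" "R \<le> 4 ^ M" "1 \<le> M" by (auto simp: eventually_sequentially)
  show ?thesis
  proof (intro exI[of _ "log_cutoff M"] conjI allI impI test_function_log_cutoff log_cutoff_bounds)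
    show "log_cutoff M x = 1" if "\<bar>x\<bar> \<le> R" for x
      using M that by (intro log_cutoff_eq_1) auto
    show "(\<integral>t. k t * (\<integral>x. (log_cutoff M (x + t) - log_cutoff M x)\<^sup>2 \<partial>lborel) \<partial>lborel) \<le> e"
      using log_cutoff_energy_le[where k = k and M = M, OF k theta D decay] M(1) by linarith
  qed
qed

section \<open>Rigidity\<close>

lemma number_rigid_fourier_kernel:
  assumes P: "determinantal_process P (fourier_kernel A)"
    and A: "A \<in> sets borel" "A \<subseteq> {0..1}"
    and theta: "0 < \<theta>" "\<theta> < 1" and D: "0 \<le> D"
    and decay: "\<And>s \<xi>. 4 ^ s \<le> \<bar>\<xi>\<bar> \<Longrightarrow>
      (norm (fourier_transform (indicator A) \<xi>))\<^sup>2 \<le> D * (1 + real s) powr \<theta> / 16 ^ s"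
  shows "number_rigid P"
proof -
  define k where "k \<xi> = (norm (fourier_transform (indicator A) \<xi>))\<^sup>2" for \<xi>
  define c where "c = measure lborel A"
  have bounded: "bounded A" using A(2) by (rule bounded_subset[OF bounded_closed_interval])
  then have fin: "emeasure lborel A < \<infinity>" by (rule emeasure_bounded_finite)
  have "c \<le> measure lborel {0..1::real}"
    unfolding c_def using A by (intro measure_mono_fmeasurable) (auto intro!: fmeasurableI simp: emeasure_lborel_Icc_eq)
  then have c_le_1: "c \<le> 1" by simp
  have k_nonneg: "0 \<le> k \<xi>" for \<xi> by (simp add: k_def)
  have k_le_1: "k \<xi> \<le> 1" for \<xi>
  proof -
    have "norm (fourier_transform (indicator A) \<xi>) \<le> 1"
      using norm_fourier_indicator_le[OF A(1) fin, of \<xi>] c_le_1 by (simp add: c_def)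
    then show ?thesis unfolding k_def by (rule power_le_one[OF norm_ge_zero])
  qed
  have k_meas: "k \<in> borel_measurable borel"
    unfolding k_def[abs_def]
    by (intro borel_measurable_power measurable_compose[OF fourier_indicator_measurable[OF A(1)] borel_measurable_norm])
  have int_k: "integrable lborel k"
    using k_meas k_nonneg k_le_1 theta D by (rule integrable_shell_decay) (use decay in \<open>simp add: k_def\<close>)
  have diag: "fourier_kernel A x x = complex_of_real c" for x
    using fourier_indicator_0[OF A(1) fin] by (simp add: fourier_kernel_def c_def)
  \<comment> \<open>The kernel is Hermitian, so the product of the off-diagonal entries is a squared
    modulus.\<close>
  have sym: "fourier_kernel A x y * fourier_kernel A y x = complex_of_real (k (x - y))" for x y
  proof -
    have "fourier_kernel A y x = cnj (fourier_kernel A x y)"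
      using fourier_indicator_uminus[of A "x - y"] by (simp add: fourier_kernel_def)
    then show ?thesis unfolding k_def fourier_kernel_def by (simp only: complex_norm_square)
  qed
  have even: "k (- t) = k t" for t by (simp add: k_def fourier_indicator_uminus)
  \<comment> \<open>The density c is the measure of A, so this is where Plancherel's inequality
    enters.\<close>
  have c_le: "c \<le> integral\<^sup>L lborel k"
    using measure_le_fourier_energy[OF A(1) bounded] int_k by (simp add: k_def[abs_def] c_def)
  note variance = linear_statistic_variance_le[OF P _ diag sym int_k even c_le]
  show ?thesis
  proof (rule number_rigid_criterion)
    show "simple_point_process P" using P by (simp add: determinantal_process_def)
    fix R e :: real assume "0 < e"
    obtain f where f: "test_function f" "\<And>x. 0 \<le> f x" "\<And>x. \<bar>x\<bar> \<le> R \<Longrightarrow> f x = 1"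
      "(\<integral>t. k t * (\<integral>x. (f (x + t) - f x)\<^sup>2 \<partial>lborel) \<partial>lborel) \<le> e"
      using exists_low_energy_cutoff[of k \<theta> D e R, OF k_nonneg k_le_1 theta D _ \<open>0 < e\<close>] decay
      unfolding k_def by blast
    have "(\<integral>X. (linear_statistic f X - integral\<^sup>L P (linear_statistic f))\<^sup>2 \<partial>P) \<le> e"
      using variance(2)[OF f(1)] f(4) \<open>0 < e\<close> by linarith
    then show "\<exists>f. test_function f \<and> (\<forall>x. 0 \<le> f x) \<and> (\<forall>x. \<bar>x\<bar> \<le> R \<longrightarrow> f x = 1) \<and>
        integrable P (\<lambda>X. (linear_statistic f X - integral\<^sup>L P (linear_statistic f))\<^sup>2) \<and>
        (\<integral>X. (linear_statistic f X - integral\<^sup>L P (linear_statistic f))\<^sup>2 \<partial>P) \<le> e"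
      using f(1-3) variance(1)[OF f(1)] by blast
  qed
qed

theorem theorem1p1:
  fixes \<alpha> :: "nat \<Rightarrow> real"
  assumes "\<And>n. n \<ge> 1 \<Longrightarrow> 0 < \<alpha> n \<and> \<alpha> n < 1"
    and "\<exists>\<delta>. 0 < \<delta> \<and> \<delta> < 1 \<and>
      summable (\<lambda>n. gap_length \<alpha> (Suc n) powr (1 / 4 powr (real (Suc n) / \<delta>)))"
  shows "(\<forall>P. determinantal_process P (fourier_kernel (cantor_set \<alpha>)) \<longrightarrow> number_rigid P) \<and>
    (\<forall>P. determinantal_process P (fourier_kernel (cantor_complement \<alpha>)) \<longrightarrow> number_rigid P)"
proof -
  interpret cantor_ratios \<alpha> by standard (rule assms(1))
  obtain \<delta> where \<delta>: "0 < \<delta>" "\<delta> < 1"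
    and sum: "summable (\<lambda>n. gap_length \<alpha> (Suc n) powr (1 / 4 powr (real (Suc n) / \<delta>)))"
    using assms(2) by blast
  from norm_fourier_cantor_decay[OF \<delta> sum] obtain D where D: "0 \<le> D"
    and decay: "\<And>A s \<xi>. A \<in> {cantor_set \<alpha>, cantor_complement \<alpha>} \<Longrightarrow> 4 ^ s \<le> \<bar>\<xi>\<bar> \<Longrightarrow>
      (norm (fourier_transform (indicator A) \<xi>))\<^sup>2 \<le> D * (1 + real s) powr ((1 + \<delta>) / 2) / 16 ^ s"
    by blast
  have rigid: "number_rigid P"
    if "determinantal_process P (fourier_kernel A)" "A \<in> {cantor_set \<alpha>, cantor_complement \<alpha>}" for P A
  proof (rule number_rigid_fourier_kernel[OF that(1) _ _ _ _ D decay[OF that(2)]])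
    show "A \<in> sets borel" "A \<subseteq> {0..1}"
      using that(2) cantor_set_borel cantor_set_subset by (auto simp: cantor_complement_def)
  qed (use \<delta> in auto)
  then show ?thesis by blast
qed

end
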